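(* Any path category, with its class of fibrations, is a tribe with propositional identity types.
   Context: **Path category.** A path category is a category $\mathcal{C}$ with two classes of maps, weak equivalences and fibrations (maps in both classes are called acyclic fibrations), such that: (1) isomorphisms are fibrations and fibrations are closed under composition; (2) the pullback of a fibration along any other map exists and is again a fibration; (3) $\mathcal{C}$ has a terminal object $1$ and every map $X\to 1$ is a fibration; (4) isomorphisms are weak equivalences; (5) weak equivalences satisfy 2-out-of-6: if $f:A\to B$, $g:B\to C$, $h:C\to D$ are composable and $gf$ and $hg$ are weak equivalences, then so are $f,g,h,hgf$; (6) for every object $B$ the diagonal $B\to B\times B$ factors as a weak equivalence $r:B\to PB$ followed by a fibration $(s,t):PB\to B\times B$; (7) every acyclic fibration has a section; (8) the pullback of an acyclic fibration along any other map exists and is again an acyclic fibration. **Tribe.** A tribe is a category $\mathcal{C}$ with a terminal object $1$ and a selected class of morphisms called fibrations such that: isomorphisms are fibrations; fibrations are closed under composition; every map $X\to 1$ is a fibration; for every fibration $p:X'\to X$ and every $f:Y\to X$ the pullback $q:Y'\to Y$ of $p$ along $f$ exists and is a fibration. **Propositional identity types.** A tribe has propositional identity types if for every fibration $A\to I$ there is a factorisation of the fibrewise diagonal $A\to A\times_I A$ as a map $r:A\to P_IA$ followed by a fibration $(s,t):P_IA\to A\times_I A$ such that: (a) if $g:V\to U$ is any pullback of $r$ along a fibration, $f:B\to A'$ is a fibration and $k:V\to B$, $l:U\to A'$ satisfy $fk=lg$, then there are $d:U\to B$ and $H:V\to P_{A'}(B)$ with $fd=l$, $sH=dg$, $tH=k$;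 (b) for every map $k:J\to I$ there are maps in both directions between $P_J(k^*A)$ and $k^*(P_IA)$ commuting with the fibrations to $k^*(A\times_I A)\cong k^*A\times_J k^*A$, where $k^*$ denotes pullback along $k$. *)

theory Defs
  imports Main
begin

section \<open>Categories\<close>

record ('o, 'm) cat =
  Ob :: "'o set"
  Mor :: "'m set"
  Dom :: "'m \<Rightarrow> 'o"
  Cod :: "'m \<Rightarrow> 'o"
  Id :: "'o \<Rightarrow> 'm"
  Comp :: "'m \<Rightarrow> 'm \<Rightarrow> 'm"  (infixr "\<cdot>\<index>" 70)

text \<open>Composition is written in the usual order: \<open>g \<cdot> f\<close> is \<open>f\<close> followed by \<open>g\<close>.\<close>

definition hom :: "('o, 'm) cat \<Rightarrow> 'o \<Rightarrow> 'o \<Rightarrow> 'm set" where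
  "hom C A B = {f \<in> Mor C. Dom C f = A \<and> Cod C f = B}"

locale category =
  fixes C :: "('o, 'm) cat" (structure)
  assumes Dom_in_Ob: "f \<in> Mor C \<Longrightarrow> Dom C f \<in> Ob C"
    and Cod_in_Ob: "f \<in> Mor C \<Longrightarrow> Cod C f \<in> Ob C"
    and Id_in_hom: "A \<in> Ob C \<Longrightarrow> Id C A \<in> hom C A A"
    and Comp_in_hom: "\<lbrakk>f \<in> hom C A B; g \<in> hom C B D\<rbrakk> \<Longrightarrow> g \<cdot> f \<in> hom C A D"
    and Comp_Id_right: "f \<in> hom C A B \<Longrightarrow> f \<cdot> Id C A = f"
    and Comp_Id_left: "f \<in> hom C A B \<Longrightarrow> Id C B \<cdot> f = f"
    and Comp_assoc:
      "\<lbrakk>f \<in> hom C A B; g \<in> hom C B D; h \<in> hom C D E\<rbrakk> \<Longrightarrow> (h \<cdot> g) \<cdot> f = h \<cdot> (g \<cdot> f)"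

definition iso :: "('o, 'm) cat \<Rightarrow> 'm \<Rightarrow> bool" where
  "iso C f \<longleftrightarrow> f \<in> Mor C \<and>
     (\<exists>g \<in> hom C (Cod C f) (Dom C f).
        g \<cdot>\<^bsub>C\<^esub> f = Id C (Dom C f) \<and> f \<cdot>\<^bsub>C\<^esub> g = Id C (Cod C f))"

definition terminal :: "('o, 'm) cat \<Rightarrow> 'o \<Rightarrow> bool" where
  "terminal C T \<longleftrightarrow> T \<in> Ob C \<and> (\<forall>X \<in> Ob C. \<exists>!f. f \<in> hom C X T)"

definition product :: "('o, 'm) cat \<Rightarrow> 'm \<Rightarrow> 'm \<Rightarrow> bool" where
  "product C p q \<longleftrightarrow>
     p \<in> Mor C \<and> q \<in> Mor C \<and> Dom C p = Dom C q \<and>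
     (\<forall>x \<in> Mor C. \<forall>y \<in> Mor C.
        Dom C x = Dom C y \<and> Cod C x = Cod C p \<and> Cod C y = Cod C q \<longrightarrow>
        (\<exists>!u. u \<in> hom C (Dom C x) (Dom C p) \<and> p \<cdot>\<^bsub>C\<^esub> u = x \<and> q \<cdot>\<^bsub>C\<^esub> u = y))"

text \<open>
  \<open>pullback C f g p q\<close>: the square \<open>f \<cdot> p = g \<cdot> q\<close> is a pullback, so \<open>q\<close> is a pullback of \<open>f\<close>
  along \<open>g\<close> and \<open>p\<close> is a pullback of \<open>g\<close> along \<open>f\<close>.
\<close>

definition pullback :: "('o, 'm) cat \<Rightarrow> 'm \<Rightarrow> 'm \<Rightarrow> 'm \<Rightarrow> 'm \<Rightarrow> bool" where
  "pullback C f g p q \<longleftrightarrow>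
     f \<in> Mor C \<and> g \<in> Mor C \<and> p \<in> Mor C \<and> q \<in> Mor C \<and>
     Cod C f = Cod C g \<and> Dom C p = Dom C q \<and> Cod C p = Dom C f \<and> Cod C q = Dom C g \<and>
     f \<cdot>\<^bsub>C\<^esub> p = g \<cdot>\<^bsub>C\<^esub> q \<and>
     (\<forall>x \<in> Mor C. \<forall>y \<in> Mor C.
        Dom C x = Dom C y \<and> Cod C x = Dom C f \<and> Cod C y = Dom C g \<and>
        f \<cdot>\<^bsub>C\<^esub> x = g \<cdot>\<^bsub>C\<^esub> y \<longrightarrow>
        (\<exists>!u. u \<in> hom C (Dom C x) (Dom C p) \<and> p \<cdot>\<^bsub>C\<^esub> u = x \<and> q \<cdot>\<^bsub>C\<^esub> u = y))"

text \<open>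
  The induced map \<open>(x, y)\<close> into the apex of a product or pullback cone \<open>p, q\<close>; meaningful only when
  such a map exists and is unique.
\<close>

definition induced :: "('o, 'm) cat \<Rightarrow> 'm \<Rightarrow> 'm \<Rightarrow> 'm \<Rightarrow> 'm \<Rightarrow> 'm" where
  "induced C p q x y =
     (THE u. u \<in> hom C (Dom C x) (Dom C p) \<and> p \<cdot>\<^bsub>C\<^esub> u = x \<and> q \<cdot>\<^bsub>C\<^esub> u = y)"

text \<open>
  For projections \<open>p, q : B \<times> B \<rightarrow> B\<close> this is the diagonal; for projections \<open>A \<times>\<^sub>I A \<rightarrow> A\<close> of a pullback
  of a map along itself it is the fibrewise diagonal.
\<close>

definition diagonal :: "('o, 'm) cat \<Rightarrow> 'm \<Rightarrow> 'm \<Rightarrow> 'm" where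
  "diagonal C p q = induced C p q (Id C (Cod C p)) (Id C (Cod C p))"

text \<open>
  The diagonal of \<open>p, q\<close> is \<open>r\<close> followed by a fibration \<open>e\<close> whose components are \<open>s\<close> and \<open>t\<close>,
  i.e.\ \<open>e = (s, t)\<close>. The path object is \<open>Cod C r\<close>.
\<close>

definition factors_diagonal ::
    "('o, 'm) cat \<Rightarrow> 'm set \<Rightarrow> 'm \<Rightarrow> 'm \<Rightarrow> 'm \<Rightarrow> 'm \<Rightarrow> 'm \<Rightarrow> bool" where
  "factors_diagonal C F p q r s t \<longleftrightarrow>
     r \<in> Mor C \<and> Dom C r = Cod C p \<and>
     (\<exists>e \<in> F. e \<in> hom C (Cod C r) (Dom C p) \<and> p \<cdot>\<^bsub>C\<^esub> e = s \<and> q \<cdot>\<^bsub>C\<^esub> e = t \<and>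
        e \<cdot>\<^bsub>C\<^esub> r = diagonal C p q)"


section \<open>Path categories\<close>

locale path_category = category C for C :: "('o, 'm) cat" (structure) +
  fixes W :: "'m set" \<comment> \<open>weak equivalences\<close>
    and F :: "'m set" \<comment> \<open>fibrations\<close>
  assumes W_subset: "W \<subseteq> Mor C"
    and F_subset: "F \<subseteq> Mor C"
    and iso_F: "iso C f \<Longrightarrow> f \<in> F"
    and Comp_F: "\<lbrakk>f \<in> F; g \<in> F; Cod C f = Dom C g\<rbrakk> \<Longrightarrow> g \<cdot> f \<in> F"
    and pullback_F_exists: "\<lbrakk>f \<in> F; g \<in> Mor C; Cod C f = Cod C g\<rbrakk> \<Longrightarrow> \<exists>p q. pullback C f g p q"
    and pullback_F: "\<lbrakk>f \<in> F; pullback C f g p q\<rbrakk> \<Longrightarrow> q \<in> F"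
    and terminal_F: "\<exists>T. terminal C T \<and> (\<forall>X \<in> Ob C. hom C X T \<subseteq> F)"
    and iso_W: "iso C f \<Longrightarrow> f \<in> W"
    and two_out_of_six:
      "\<lbrakk>f \<in> hom C A B; g \<in> hom C B D; h \<in> hom C D E; g \<cdot> f \<in> W; h \<cdot> g \<in> W\<rbrakk> \<Longrightarrow>
         f \<in> W \<and> g \<in> W \<and> h \<in> W \<and> h \<cdot> (g \<cdot> f) \<in> W"
    and path_objects:
      "\<lbrakk>product C p q; Cod C p = B; Cod C q = B\<rbrakk> \<Longrightarrow>
         \<exists>r s t. r \<in> W \<and> factors_diagonal C F p q r s t"
    and acyclic_section:
      "f \<in> W \<inter> F \<Longrightarrow> \<exists>\<sigma> \<in> hom C (Cod C f) (Dom C f). f \<cdot> \<sigma> = Id C (Cod C f)"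
    and pullback_acyclic_exists:
      "\<lbrakk>f \<in> W \<inter> F; g \<in> Mor C; Cod C f = Cod C g\<rbrakk> \<Longrightarrow> \<exists>p q. pullback C f g p q"
    and pullback_acyclic: "\<lbrakk>f \<in> W \<inter> F; pullback C f g p q\<rbrakk> \<Longrightarrow> q \<in> W \<inter> F"


section \<open>Tribes\<close>

locale tribe = category C for C :: "('o, 'm) cat" (structure) +
  fixes F :: "'m set" \<comment> \<open>fibrations\<close>
  assumes F_subset: "F \<subseteq> Mor C"
    and iso_F: "iso C f \<Longrightarrow> f \<in> F"
    and Comp_F: "\<lbrakk>f \<in> F; g \<in> F; Cod C f = Dom C g\<rbrakk> \<Longrightarrow> g \<cdot> f \<in> F"
    and terminal_F: "\<exists>T. terminal C T \<and> (\<forall>X \<in> Ob C. hom C X T \<subseteq> F)"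
    and pullback_F_exists: "\<lbrakk>f \<in> F; g \<in> Mor C; Cod C f = Cod C g\<rbrakk> \<Longrightarrow> \<exists>p q. pullback C f g p q"
    and pullback_F: "\<lbrakk>f \<in> F; pullback C f g p q\<rbrakk> \<Longrightarrow> q \<in> F"

text \<open>
  The identity types are one family of factorisations, indexed by all fibrations: the elimination
  property for \<open>p\<close> refers to the path object of a second fibration \<open>f\<close>, and stability refers to the
  path object of a pullback of \<open>p\<close>. For a fibration \<open>p : A \<rightarrow> I\<close>, the path object \<open>P\<^sub>I A\<close> is
  \<open>Cod C (r p)\<close>, with \<open>r p : A \<rightarrow> P\<^sub>I A\<close> and \<open>s p, t p : P\<^sub>I A \<rightarrow> A\<close>. Nothing is assumed about chosen
  pullbacks; all conditions are required for every choice of pullback cones.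
\<close>

definition diagonal_factorisations ::
    "('o, 'm) cat \<Rightarrow> 'm set \<Rightarrow> ('m \<Rightarrow> 'm) \<Rightarrow> ('m \<Rightarrow> 'm) \<Rightarrow> ('m \<Rightarrow> 'm) \<Rightarrow> bool" where
  "diagonal_factorisations C F r s t \<longleftrightarrow>
     (\<forall>p \<in> F. \<forall>\<pi>1 \<pi>2. pullback C p p \<pi>1 \<pi>2 \<longrightarrow>
        factors_diagonal C F \<pi>1 \<pi>2 (r p) (s p) (t p))"

text \<open>
  Here \<open>g : V \<rightarrow> U\<close> is a pullback of \<open>r p\<close> along the fibration \<open>u : U \<rightarrow> P\<^sub>I A\<close>.
\<close>

definition propositional_elimination ::
    "('o, 'm) cat \<Rightarrow> 'm set \<Rightarrow> ('m \<Rightarrow> 'm) \<Rightarrow> ('m \<Rightarrow> 'm) \<Rightarrow> ('m \<Rightarrow> 'm) \<Rightarrow> bool" where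
  "propositional_elimination C F r s t \<longleftrightarrow>
     (\<forall>p \<in> F. \<forall>u \<in> F. \<forall>v g. pullback C (r p) u v g \<longrightarrow>
        (\<forall>f \<in> F. \<forall>k \<in> hom C (Dom C g) (Dom C f). \<forall>l \<in> hom C (Cod C g) (Cod C f).
           f \<cdot>\<^bsub>C\<^esub> k = l \<cdot>\<^bsub>C\<^esub> g \<longrightarrow>
           (\<exists>d \<in> hom C (Cod C g) (Dom C f). \<exists>H \<in> hom C (Dom C g) (Cod C (r f)).
              f \<cdot>\<^bsub>C\<^esub> d = l \<and> s f \<cdot>\<^bsub>C\<^esub> H = d \<cdot>\<^bsub>C\<^esub> g \<and> t f \<cdot>\<^bsub>C\<^esub> H = k)))"

text \<open>
  For \<open>p : A \<rightarrow> I\<close> and \<open>k : J \<rightarrow> I\<close>, the cones below have the following apexes: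
  \<open>A \<times>\<^sub>I A\<close> for \<open>\<pi>1, \<pi>2\<close>; \<open>k\<^sup>*A\<close> for \<open>a, q\<close>, where \<open>q : k\<^sup>*A \<rightarrow> J\<close>; \<open>k\<^sup>*A \<times>\<^sub>J k\<^sup>*A\<close> for \<open>\<rho>1, \<rho>2\<close>;
  \<open>k\<^sup>*(P\<^sub>I A)\<close> for \<open>b, w\<close>; and \<open>k\<^sup>*(A \<times>\<^sub>I A)\<close> for \<open>c, z\<close>. Then \<open>\<epsilon> : P\<^sub>I A \<rightarrow> A \<times>\<^sub>I A\<close> and
  \<open>\<epsilon>' : P\<^sub>J(k\<^sup>*A) \<rightarrow> k\<^sup>*A \<times>\<^sub>J k\<^sup>*A\<close> are the fibrations \<open>(s, t)\<close>, \<open>k\<epsilon>\<close> is \<open>k\<^sup>*\<epsilon>\<close>, and \<open>\<theta>\<close> is the canonical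
  isomorphism \<open>k\<^sup>*(A \<times>\<^sub>I A) \<cong> k\<^sup>*A \<times>\<^sub>J k\<^sup>*A\<close>.
\<close>

definition pullback_stable ::
    "('o, 'm) cat \<Rightarrow> 'm set \<Rightarrow> ('m \<Rightarrow> 'm) \<Rightarrow> ('m \<Rightarrow> 'm) \<Rightarrow> ('m \<Rightarrow> 'm) \<Rightarrow> bool" where
  "pullback_stable C F r s t \<longleftrightarrow>
     (\<forall>p \<in> F. \<forall>k \<in> Mor C. \<forall>\<pi>1 \<pi>2 a q \<rho>1 \<rho>2 b w c z.
        Cod C k = Cod C p \<and>
        pullback C p p \<pi>1 \<pi>2 \<and>
        pullback C p k a q \<and>
        pullback C q q \<rho>1 \<rho>2 \<and>
        pullback C (p \<cdot>\<^bsub>C\<^esub> \<pi>1 \<cdot>\<^bsub>C\<^esub> induced C \<pi>1 \<pi>2 (s p) (t p)) k b w \<and>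
        pullback C (p \<cdot>\<^bsub>C\<^esub> \<pi>1) k c z \<longrightarrow>
        (let \<epsilon> = induced C \<pi>1 \<pi>2 (s p) (t p);
             \<epsilon>' = induced C \<rho>1 \<rho>2 (s q) (t q);
             k\<epsilon> = induced C c z (\<epsilon> \<cdot>\<^bsub>C\<^esub> b) w;
             \<theta> = induced C \<rho>1 \<rho>2 (induced C a q (\<pi>1 \<cdot>\<^bsub>C\<^esub> c) z) (induced C a q (\<pi>2 \<cdot>\<^bsub>C\<^esub> c) z)
         in (\<exists>m \<in> hom C (Cod C (r q)) (Dom C b). (\<theta> \<cdot>\<^bsub>C\<^esub> k\<epsilon>) \<cdot>\<^bsub>C\<^esub> m = \<epsilon>') \<and>
            (\<exists>n \<in> hom C (Dom C b) (Cod C (r q)). \<epsilon>' \<cdot>\<^bsub>C\<^esub> n = \<theta> \<cdot>\<^bsub>C\<^esub> k\<epsilon>)))"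

definition has_propositional_identity_types :: "('o, 'm) cat \<Rightarrow> 'm set \<Rightarrow> bool" where
  "has_propositional_identity_types C F \<longleftrightarrow>
     (\<exists>r s t. diagonal_factorisations C F r s t \<and>
        propositional_elimination C F r s t \<and>
        pullback_stable C F r s t)"

end

theory Submission
  imports Defs
begin

text \<open>
  The tribe axioms are among those of a path category; the work is in the identity types.
  A path category has path objects only for its objects, whereas identity types are path objects for
  fibrations \<open>A \<rightarrow> I\<close>, that is, path objects fibrewise over \<open>I\<close>. They come from the mapping path
  space construction: pulling back the path object of \<open>X\<close> shows that every map \<open>Y \<rightarrow> X\<close> is a weak
  equivalence followed by a fibration (\<open>factorisation\<close>), and applying this to the diagonal
  \<open>A \<rightarrow> A \<times>\<^sub>I A\<close> yields \<open>r : A \<rightarrow> P\<^sub>I A\<close> and \<open>(s, t)\<close> with \<open>r\<close> a weak equivalence. It remains to see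
  that the elimination rule and stability hold for any such choice.

  Both rest on \<open>weak_equivalence_lifting\<close>: a square from a weak equivalence to a fibration has a
  diagonal filler for which the lower triangle commutes and the upper triangle commutes up to fibrewise
  homotopy. The filler is obtained by factoring the upper edge so that the lower edge becomes liftable
  through an acyclic fibration, which has a section; the homotopy comes from a section of a second fibration,
  obtained in the same way (\<open>fibration_section\<close>).

  The elimination rule is this lifting theorem applied to a pullback \<open>g\<close> of \<open>r\<close> along a fibration, as
  soon as \<open>g\<close> is known to be a weak equivalence. The axioms give this for pullbacks of acyclic
  fibrations only, and \<open>r\<close> need not be a fibration; but \<open>r\<close> is a section of the acyclic fibration \<open>s\<close>, and
  the lifting theorem provides a transport map, out of which one builds a map opposite to \<open>g\<close> whose two
  composites with \<open>g\<close> are weak equivalences (\<open>section_pullback_W\<close>).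

  Stability is the statement that two factorisations of one diagonal, each a weak equivalence followed by a fibration, can be compared in both directions; that
  \<open>k\<^sup>*(P\<^sub>I A)\<close> provides such a factorisation is seen by recognising its structure maps as pullbacks
  of \<open>(s, t)\<close> and of \<open>s\<close>.
\<close>

section \<open>Arrows and pullback cones\<close>

context category
begin

lemma Comp_arrow:
  assumes "f \<in> Mor C" "g \<in> Mor C" "Cod C f = Dom C g"
  shows Comp_Mor: "g \<cdot> f \<in> Mor C"
    and Dom_Comp: "Dom C (g \<cdot> f) = Dom C f"
    and Cod_Comp: "Cod C (g \<cdot> f) = Cod C g"
  using Comp_in_hom[of f "Dom C f" "Dom C g" g "Cod C g"] assms by (auto simp: hom_def)

lemma Comp_assoc_Mor:
  "\<lbrakk>f \<in> Mor C; g \<in> Mor C; h \<in> Mor C; Cod C f = Dom C g; Cod C g = Dom C h\<rbrakk> \<Longrightarrow>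
    (h \<cdot> g) \<cdot> f = h \<cdot> (g \<cdot> f)"
  using Comp_assoc[of f "Dom C f" "Dom C g" g "Dom C h" h "Cod C h"] by (auto simp: hom_def)

lemma Id_arrow:
  assumes "A \<in> Ob C"
  shows Id_Mor: "Id C A \<in> Mor C" and Dom_Id: "Dom C (Id C A) = A" and Cod_Id: "Cod C (Id C A) = A"
  using Id_in_hom[OF assms] by (auto simp: hom_def)

lemma Comp_Id_Mor:
  assumes "f \<in> Mor C"
  shows Comp_Id_Dom: "Dom C f = A \<Longrightarrow> f \<cdot> Id C A = f"
    and Comp_Id_Cod: "Cod C f = A \<Longrightarrow> Id C A \<cdot> f = f"
  using assms Comp_Id_right[of f A "Cod C f"] Comp_Id_left[of f "Dom C f" A] by (auto simp: hom_def)

lemma hom_Ob: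
  assumes "f \<in> hom C A B" shows hom_Dom_Ob: "A \<in> Ob C" and hom_Cod_Ob: "B \<in> Ob C"
  using assms Dom_in_Ob Cod_in_Ob by (auto simp: hom_def)

lemmas arrow_simps = hom_def Comp_Mor Dom_Comp Cod_Comp Comp_assoc_Mor Id_Mor Dom_Id Cod_Id
  Comp_Id_Dom Comp_Id_Cod

text \<open>
  With composites bracketed to the right, an equation between composites can be used for rewriting
  only after it has been composed with an arbitrary arrow.
\<close>

lemma Comp_eq_extend:
  "\<lbrakk>f \<cdot> g = h; f \<in> Mor C; g \<in> Mor C; x \<in> Mor C; Cod C x = Dom C g; Cod C g = Dom C f\<rbrakk> \<Longrightarrow>
    f \<cdot> (g \<cdot> x) = h \<cdot> x"
  by (simp flip: Comp_assoc_Mor)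

lemma pullback_homs:
  assumes "pullback C f g p q" "f \<in> hom C A I" "g \<in> hom C B I"
  obtains X where "p \<in> hom C X A" "q \<in> hom C X B" "f \<cdot> p = g \<cdot> q"
  using assms by (auto simp: pullback_def hom_def)

lemma pullback_universal:
  assumes "pullback C f g p q" "p \<in> hom C X A" "q \<in> hom C X B"
    and "x \<in> hom C Z A" "y \<in> hom C Z B" "f \<cdot> x = g \<cdot> y"
  shows "\<exists>!u. u \<in> hom C Z X \<and> p \<cdot> u = x \<and> q \<cdot> u = y"
proof -
  have typing: "x \<in> Mor C" "y \<in> Mor C" "Dom C x = Z" "Dom C p = X"
    "Dom C x = Dom C y \<and> Cod C x = Dom C f \<and> Cod C y = Dom C g \<and> f \<cdot> x = g \<cdot> y"
    using assms by (auto simp: pullback_def hom_def)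
  have "\<forall>x \<in> Mor C. \<forall>y \<in> Mor C.
      Dom C x = Dom C y \<and> Cod C x = Dom C f \<and> Cod C y = Dom C g \<and> f \<cdot> x = g \<cdot> y \<longrightarrow>
      (\<exists>!u. u \<in> hom C (Dom C x) (Dom C p) \<and> p \<cdot> u = x \<and> q \<cdot> u = y)"
    using assms(1) unfolding pullback_def by (elim conjE)
  from this[rule_format, OF typing(1,2,5)] show ?thesis unfolding typing(3,4) .
qed

lemma pullback_induced:
  assumes "pullback C f g p q" "p \<in> hom C X A" "q \<in> hom C X B"
    and "x \<in> hom C Z A" "y \<in> hom C Z B" "f \<cdot> x = g \<cdot> y"
  shows "induced C p q x y \<in> hom C Z X" "p \<cdot> induced C p q x y = x" "q \<cdot> induced C p q x y = y"
proof -
  have "Dom C x = Z" "Dom C p = X" using assms(2,4) by (auto simp: hom_def)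
  with theI'[OF pullback_universal[OF assms]]
  show "induced C p q x y \<in> hom C Z X" "p \<cdot> induced C p q x y = x" "q \<cdot> induced C p q x y = y"
    by (auto simp: induced_def)
qed

lemma pullback_cancel:
  assumes "pullback C f g p q" "p \<in> hom C X A" "q \<in> hom C X B"
    and "u \<in> hom C Z X" "u' \<in> hom C Z X" "p \<cdot> u = p \<cdot> u'" "q \<cdot> u = q \<cdot> u'"
  shows "u = u'"
proof -
  have "p \<cdot> u \<in> hom C Z A" "q \<cdot> u \<in> hom C Z B" using assms(2-4) by (auto simp: arrow_simps)
  moreover have "f \<cdot> (p \<cdot> u) = g \<cdot> (q \<cdot> u)"
    using assms(1-4) by (auto simp: pullback_def arrow_simps simp flip: Comp_assoc_Mor)
  ultimately show ?thesis
    using pullback_universal[OF assms(1-3)] assms(4-) by metis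
qed

lemma induced_eqI:
  assumes "pullback C f g p q" "p \<in> hom C X A" "q \<in> hom C X B" "u \<in> hom C Z X"
    "p \<cdot> u = x" "q \<cdot> u = y"
  shows "induced C p q x y = u"
proof -
  have "x \<in> hom C Z A" "y \<in> hom C Z B" using assms(2-) by (auto simp: arrow_simps)
  moreover have "f \<cdot> x = g \<cdot> y"
    using assms by (auto simp: pullback_def arrow_simps simp flip: Comp_assoc_Mor)
  ultimately show ?thesis
    using pullback_cancel[OF assms(1-3) _ assms(4)] pullback_induced[OF assms(1-3)] assms(5,6) by auto
qed

lemma pullbackI:
  assumes "f \<in> hom C A I" "g \<in> hom C B I" "p \<in> hom C X A" "q \<in> hom C X B" "f \<cdot> p = g \<cdot> q"
    and "\<And>Z x y. \<lbrakk>x \<in> hom C Z A; y \<in> hom C Z B; f \<cdot> x = g \<cdot> y\<rbrakk> \<Longrightarrow>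
           \<exists>u \<in> hom C Z X. p \<cdot> u = x \<and> q \<cdot> u = y"
    and "\<And>Z u u'. \<lbrakk>u \<in> hom C Z X; u' \<in> hom C Z X; p \<cdot> u = p \<cdot> u'; q \<cdot> u = q \<cdot> u'\<rbrakk> \<Longrightarrow> u = u'"
  shows "pullback C f g p q"
  unfolding pullback_def
proof (intro conjI ballI impI)
  fix x y
  assume xy: "x \<in> Mor C" "y \<in> Mor C"
    "Dom C x = Dom C y \<and> Cod C x = Dom C f \<and> Cod C y = Dom C g \<and> f \<cdot> x = g \<cdot> y"
  then have "x \<in> hom C (Dom C x) A" "y \<in> hom C (Dom C x) B" using assms(1,2) by (auto simp: hom_def)
  then obtain u where "u \<in> hom C (Dom C x) X" "p \<cdot> u = x" "q \<cdot> u = y" using assms(6) xy(3) by blast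
  moreover have "Dom C p = X" using assms(3) by (simp add: hom_def)
  ultimately show "\<exists>!u. u \<in> hom C (Dom C x) (Dom C p) \<and> p \<cdot> u = x \<and> q \<cdot> u = y"
    using assms(7) by metis
qed (use assms(1-5) in \<open>auto simp: hom_def\<close>)

lemma pullback_sym: "pullback C f g p q \<Longrightarrow> pullback C g f q p"
  unfolding pullback_def by (safe; metis)

lemma pullback_paste:
  assumes "pullback C g h p q" "pullback C f p a b"
  shows "pullback C (g \<cdot> f) h a (q \<cdot> b)"
proof -
  define B where "B = Dom C g"
  define D where "D = Dom C h"
  define I where "I = Cod C g"
  define A where "A = Dom C f"
  have gh: "g \<in> hom C B I" "h \<in> hom C D I"
    using assms(1) by (auto simp: pullback_def hom_def B_def I_def D_def)
  obtain X where pq: "p \<in> hom C X B" "q \<in> hom C X D" "g \<cdot> p = h \<cdot> q"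
    using pullback_homs[OF assms(1) gh] .
  have f: "f \<in> hom C A B" using assms(2) pq by (auto simp: pullback_def hom_def A_def)
  obtain Y where ab: "a \<in> hom C Y A" "b \<in> hom C Y X" "f \<cdot> a = p \<cdot> b"
    using pullback_homs[OF assms(2) f pq(1)] .
  note typing = gh pq(1,2) f ab(1,2)
  show ?thesis
  proof (rule pullbackI[where A = A and B = D and I = I and X = Y])
    show "(g \<cdot> f) \<cdot> a = h \<cdot> (q \<cdot> b)"
      using typing Comp_eq_extend[OF pq(3)] by (simp add: arrow_simps ab(3))
  next
    fix Z x y
    assume xy: "x \<in> hom C Z A" "y \<in> hom C Z D" "(g \<cdot> f) \<cdot> x = h \<cdot> y"
    have fx: "f \<cdot> x \<in> hom C Z B" "g \<cdot> (f \<cdot> x) = h \<cdot> y"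
      using typing xy by (auto simp: arrow_simps)
    note v = pullback_induced[OF assms(1) pq(1,2) fx(1) xy(2) fx(2)]
    let ?v = "induced C p q (f \<cdot> x) y"
    note u = pullback_induced[OF assms(2) ab(1,2) xy(1) v(1) v(2)[symmetric]]
    let ?u = "induced C a b x ?v"
    have "(q \<cdot> b) \<cdot> ?u = y" using typing u v xy by (simp add: arrow_simps)
    then show "\<exists>u \<in> hom C Z Y. a \<cdot> u = x \<and> (q \<cdot> b) \<cdot> u = y" using u by blast
  next
    fix Z u u'
    assume u: "u \<in> hom C Z Y" "u' \<in> hom C Z Y" "a \<cdot> u = a \<cdot> u'" "(q \<cdot> b) \<cdot> u = (q \<cdot> b) \<cdot> u'"
    have "p \<cdot> (b \<cdot> u) = p \<cdot> (b \<cdot> u')"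
      using typing u(1,2,3) Comp_eq_extend[OF ab(3)[symmetric]] by (simp add: arrow_simps)
    moreover have "q \<cdot> (b \<cdot> u) = q \<cdot> (b \<cdot> u')" using typing u by (simp add: arrow_simps)
    moreover have "b \<cdot> u \<in> hom C Z X" "b \<cdot> u' \<in> hom C Z X" using typing u by (auto simp: arrow_simps)
    ultimately have "b \<cdot> u = b \<cdot> u'" using pullback_cancel[OF assms(1) pq(1,2)] by blast
    then show "u = u'" using pullback_cancel[OF assms(2) ab(1,2) u(1,2,3)] by blast
  qed (use typing in \<open>auto simp: arrow_simps\<close>)
qed

lemma pullback_unpaste:
  assumes "pullback C g h p q" "pullback C (g \<cdot> f) h a c" "f \<in> hom C A B" "g \<in> hom C B I"
    and "b \<in> Mor C" "p \<cdot> b = f \<cdot> a" "q \<cdot> b = c" "Cod C b = Dom C p"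
  shows "pullback C f p a b"
proof -
  define D where "D = Dom C h"
  have h: "h \<in> hom C D I"
    using assms(1,4) by (auto simp: pullback_def hom_def D_def)
  obtain X where pq: "p \<in> hom C X B" "q \<in> hom C X D" "g \<cdot> p = h \<cdot> q"
    using pullback_homs[OF assms(1,4) h] .
  have gf: "g \<cdot> f \<in> hom C A I" using assms(3,4) by (auto simp: arrow_simps)
  obtain Y where ac: "a \<in> hom C Y A" "c \<in> hom C Y D" "(g \<cdot> f) \<cdot> a = h \<cdot> c"
    using pullback_homs[OF assms(2) gf h] .
  have b: "b \<in> hom C Y X"
    using assms(5,8) pq ac Dom_Comp[of b q] unfolding assms(7) by (auto simp: hom_def)
  note typing = assms(3,4) h pq(1,2) ac(1,2) b
  show ?thesis
  proof (rule pullbackI[where A = A and B = X and I = B and X = Y])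
    fix Z x y
    assume xy: "x \<in> hom C Z A" "y \<in> hom C Z X" "f \<cdot> x = p \<cdot> y"
    have qy: "q \<cdot> y \<in> hom C Z D" "(g \<cdot> f) \<cdot> x = h \<cdot> (q \<cdot> y)"
      using typing xy Comp_eq_extend[OF pq(3)] by (auto simp: arrow_simps)
    note u = pullback_induced[OF assms(2) ac(1,2) xy(1) qy]
    let ?u = "induced C a c x (q \<cdot> y)"
    have "b \<cdot> ?u = y"
    proof (rule pullback_cancel[OF assms(1) pq(1,2)])
      show "p \<cdot> (b \<cdot> ?u) = p \<cdot> y"
        using typing u xy Comp_eq_extend[OF assms(6)] by (simp add: arrow_simps)
      show "q \<cdot> (b \<cdot> ?u) = q \<cdot> y"
        using typing u xy Comp_eq_extend[OF assms(7)] by (simp add: arrow_simps)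
    qed (use typing u xy in \<open>auto simp: arrow_simps\<close>)
    then show "\<exists>u \<in> hom C Z Y. a \<cdot> u = x \<and> b \<cdot> u = y" using u by blast
  next
    fix Z u u'
    assume u: "u \<in> hom C Z Y" "u' \<in> hom C Z Y" "a \<cdot> u = a \<cdot> u'" "b \<cdot> u = b \<cdot> u'"
    have "c \<cdot> u = c \<cdot> u'"
      using typing u Comp_assoc_Mor[of u b q] Comp_assoc_Mor[of u' b q]
      by (simp add: hom_def flip: assms(7))
    then show "u = u'" using pullback_cancel[OF assms(2) ac(1,2) u(1,2,3)] by blast
  qed (use typing assms in \<open>auto simp: arrow_simps\<close>)
qed

lemma pullback_cone_iso:
  assumes "pullback C f g p q" "pullback C f g p' q'" "p \<in> hom C X A" "q \<in> hom C X B"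
    "p' \<in> hom C X' A" "q' \<in> hom C X' B"
  obtains \<phi> where "\<phi> \<in> hom C X X'" "iso C \<phi>" "p' \<cdot> \<phi> = p" "q' \<cdot> \<phi> = q"
proof -
  have sq: "f \<cdot> p = g \<cdot> q" "f \<cdot> p' = g \<cdot> q'" using assms(1,2) by (auto simp: pullback_def)
  note \<phi> = pullback_induced[OF assms(2,5,6,3,4) sq(1)]
  note \<psi> = pullback_induced[OF assms(1,3,4,5,6) sq(2)]
  let ?\<phi> = "induced C p' q' p q" and ?\<psi> = "induced C p q p' q'"
  note typing = assms(3-6) \<phi>(1) \<psi>(1)
  have Ob: "X \<in> Ob C" "X' \<in> Ob C" using hom_Ob assms(3,5) by auto
  have "?\<psi> \<cdot> ?\<phi> = Id C X"
    by (rule pullback_cancel[OF assms(1,3,4)])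
      (use typing Ob Comp_eq_extend[OF \<psi>(2)] Comp_eq_extend[OF \<psi>(3)] in
        \<open>auto simp: arrow_simps \<phi>(2,3)\<close>)
  moreover have "?\<phi> \<cdot> ?\<psi> = Id C X'"
    by (rule pullback_cancel[OF assms(2,5,6)])
      (use typing Ob Comp_eq_extend[OF \<phi>(2)] Comp_eq_extend[OF \<phi>(3)] in
        \<open>auto simp: arrow_simps \<psi>(2,3)\<close>)
  ultimately have "iso C ?\<phi>" using \<phi>(1) \<psi>(1) by (auto simp: iso_def hom_def)
  then show ?thesis using that \<phi> by blast
qed

end


section \<open>Factorisations in a path category\<close>

context path_category
begin

lemma Id_W: "A \<in> Ob C \<Longrightarrow> Id C A \<in> W"
  by (rule iso_W) (auto simp: iso_def arrow_simps intro!: bexI[of _ "Id C A"])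

text \<open>
  The three instances of 2-out-of-3 are 2-out-of-6 with an identity in the middle, at the end and at the
  beginning.
\<close>

lemma W_Comp:
  assumes "f \<in> hom C A B" "g \<in> hom C B D" "f \<in> W" "g \<in> W" shows "g \<cdot> f \<in> W"
proof -
  have "Id C B \<in> hom C B B" using Id_in_hom hom_Cod_Ob[OF assms(1)] by blast
  from two_out_of_six[OF assms(1) this assms(2)] assms show ?thesis
    by (simp add: Comp_Id_left[OF assms(1)] Comp_Id_right[OF assms(2)])
qed

lemma W_cancel_left:
  assumes "f \<in> hom C A B" "g \<in> hom C B D" "g \<in> W" "g \<cdot> f \<in> W" shows "f \<in> W"
  using two_out_of_six[OF assms(1,2) Id_in_hom[OF hom_Cod_Ob[OF assms(2)]]] assms(3,4)
  by (simp add: Comp_Id_left[OF assms(2)])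

lemma W_cancel_right:
  assumes "f \<in> hom C A B" "g \<in> hom C B D" "f \<in> W" "g \<cdot> f \<in> W" shows "g \<in> W"
  using two_out_of_six[OF Id_in_hom[OF hom_Dom_Ob[OF assms(1)]] assms(1,2)] assms(3,4)
  by (simp add: Comp_Id_right[OF assms(1)])

lemma section_W:
  assumes "f \<in> hom C A B" "g \<in> hom C B A" "g \<in> W" "g \<cdot> f = Id C A" shows "f \<in> W"
  using W_cancel_left[OF assms(1,2,3)] assms(4) Id_W hom_Ob[OF assms(1)] by simp

lemma retraction_W:
  assumes "f \<in> hom C A B" "g \<in> hom C B A" "f \<in> W" "g \<cdot> f = Id C A" shows "g \<in> W"
  using W_cancel_right[OF assms(1,2,3)] assms(4) Id_W hom_Ob[OF assms(1)] by simp

lemma fibration_pullback: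
  assumes "f \<in> F" "f \<in> hom C A I" "g \<in> hom C B I"
  obtains X p q where "pullback C f g p q" "p \<in> hom C X A" "q \<in> hom C X B" "f \<cdot> p = g \<cdot> q" "q \<in> F"
proof -
  obtain p q where pb: "pullback C f g p q"
    using pullback_F_exists[OF assms(1), of g] assms(2,3) by (auto simp: hom_def)
  show ?thesis using pullback_homs[OF pb assms(2,3)] pullback_F[OF assms(1) pb] that pb by metis
qed

text \<open>
  The middle object is the mapping path space \<open>E = {(y, \<gamma>) | \<gamma> starts at f y}\<close>; the first factor sends
  \<open>y\<close> to the constant path at \<open>f y\<close>, and the second evaluates the path at its end. The first factor is a
  weak equivalence because it is a section of \<open>E \<rightarrow> Y\<close>, a pullback of the acyclic fibration \<open>s\<close>. The
  second is a fibration because \<open>E\<close> is also the pullback of \<open>(s, t)\<close> along \<open>f \<times> 1 : Y \<times> X \<rightarrow> X \<times> X\<close>.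
\<close>

lemma factorisation:
  assumes f: "f \<in> hom C Y X"
  obtains E n e where "n \<in> W" "n \<in> hom C Y E" "e \<in> F" "e \<in> hom C E X" "e \<cdot> n = f"
proof -
  have YX: "Y \<in> Ob C" "X \<in> Ob C" using f by (rule hom_Ob)+
  obtain T where T: "terminal C T" "\<And>Z. Z \<in> Ob C \<Longrightarrow> hom C Z T \<subseteq> F" using terminal_F by blast
  \<comment> \<open>Pullbacks over the terminal object are products, which gives a path object \<open>P\<close> for \<open>X\<close>.\<close>
  obtain x where x: "x \<in> hom C X T" using T(1) YX by (auto simp: terminal_def)
  have xF: "x \<in> F" using T(2) YX(2) x by blast
  obtain XX p1 p2 where pb: "pullback C x x p1 p2"
    and p: "p1 \<in> hom C XX X" "p2 \<in> hom C XX X" and pF: "p2 \<in> F"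
    using fibration_pullback[OF xF x x] .
  have p1F: "p1 \<in> F" using pullback_F[OF xF pullback_sym[OF pb]] .
  have "product C p1 p2"
    unfolding product_def
  proof (intro conjI ballI impI)
    fix a b
    assume ab: "a \<in> Mor C" "b \<in> Mor C"
      "Dom C a = Dom C b \<and> Cod C a = Cod C p1 \<and> Cod C b = Cod C p2"
    have "x \<cdot> a \<in> hom C (Dom C a) T" "x \<cdot> b \<in> hom C (Dom C a) T"
      using ab x p by (auto simp: arrow_simps)
    then have "x \<cdot> a = x \<cdot> b" using T(1) Dom_in_Ob[OF ab(1)] unfolding terminal_def by blast
    moreover have "a \<in> hom C (Dom C a) X" "b \<in> hom C (Dom C a) X" "Dom C p1 = XX"
      using ab p by (auto simp: hom_def)
    ultimately show "\<exists>!u. u \<in> hom C (Dom C a) (Dom C p1) \<and> p1 \<cdot> u = a \<and> p2 \<cdot> u = b"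
      using pullback_universal[OF pb p] by simp
  qed (use p in \<open>auto simp: hom_def\<close>)
  then obtain r s t where rst: "r \<in> W" "factors_diagonal C F p1 p2 r s t"
    using path_objects[of p1 p2 X] p by (auto simp: hom_def)
  define P where "P = Cod C r"
  obtain e where e: "e \<in> F" "e \<in> hom C P XX" "e \<cdot> r = diagonal C p1 p2"
    using rst(2) p unfolding factors_diagonal_def P_def by (auto simp: hom_def)
  have r: "r \<in> hom C X P" using rst(2) p by (auto simp: factors_diagonal_def P_def hom_def)
  have IdX: "Id C X \<in> hom C X X" using Id_in_hom YX(2) .
  note diag = pullback_induced[OF pb p IdX IdX refl]
  have dia: "diagonal C p1 p2 = induced C p1 p2 (Id C X) (Id C X)"
    using p by (simp add: diagonal_def hom_def)
  have sr: "p1 \<cdot> (e \<cdot> r) = Id C X" "p2 \<cdot> (e \<cdot> r) = Id C X"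
    using diag e(3) dia by auto
  have s: "p1 \<cdot> e \<in> hom C P X" using p e by (auto simp: arrow_simps)
  have s_acyclic: "p1 \<cdot> e \<in> W \<inter> F"
  proof
    show "p1 \<cdot> e \<in> F" using Comp_F[OF e(1) p1F] p e by (auto simp: hom_def)
    show "p1 \<cdot> e \<in> W"
      by (rule retraction_W[OF r s rst(1)]) (use sr p e r in \<open>simp add: arrow_simps\<close>)
  qed
  \<comment> \<open>\<open>Y \<times> X\<close> is represented as the pullback of \<open>p1\<close> along \<open>f\<close>, so that \<open>c\<close> is \<open>f \<times> 1\<close>.\<close>
  obtain YX c y where pbc: "pullback C p1 f c y" and cy: "c \<in> hom C YX XX" "y \<in> hom C YX Y"
    using fibration_pullback[OF p1F p(1) f] .
  obtain E b d where pbd: "pullback C e c b d" and bd: "b \<in> hom C E P" "d \<in> hom C E YX"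
    "e \<cdot> b = c \<cdot> d" and dF: "d \<in> F"
    using fibration_pullback[OF e(1,2) cy(1)] .
  note typing = p e(2) r f cy bd(1,2)
  have v: "y \<cdot> d \<in> hom C E Y" using typing by (auto simp: arrow_simps)
  \<comment> \<open>Pasting identifies \<open>E \<rightarrow> Y\<close> as a pullback of \<open>s\<close> along \<open>f\<close>, and \<open>Y \<times> X \<rightarrow> X\<close> as one of \<open>Y \<rightarrow> 1\<close>.\<close>
  have pbv: "pullback C (p1 \<cdot> e) f b (y \<cdot> d)" using pullback_paste[OF pbc pbd] .
  have vW: "y \<cdot> d \<in> W" using pullback_acyclic[OF s_acyclic pbv] by blast
  have "x \<cdot> f \<in> F" using T(2)[OF YX(1)] x f by (auto simp: arrow_simps)
  then have p2cF: "p2 \<cdot> c \<in> F"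
    using pullback_F[OF _ pullback_paste[OF pb pullback_sym[OF pbc]]] by blast
  have IdY: "Id C Y \<in> hom C Y Y" using Id_in_hom YX(1) .
  have rf: "r \<cdot> f \<in> hom C Y P" "(p1 \<cdot> e) \<cdot> (r \<cdot> f) = f \<cdot> Id C Y"
    using typing YX Comp_eq_extend[OF sr(1)] by (auto simp: arrow_simps)
  note n = pullback_induced[OF pbv bd(1) v rf(1) IdY rf(2)]
  let ?n = "induced C b (y \<cdot> d) (r \<cdot> f) (Id C Y)"
  show ?thesis
  proof (rule that)
    show "?n \<in> W" using section_W[OF n(1) v vW n(3)] .
    show "?n \<in> hom C Y E" using n(1) .
    show "(p2 \<cdot> c) \<cdot> d \<in> F"
      by (rule Comp_F[OF dF p2cF]) (use typing in \<open>auto simp: arrow_simps\<close>)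
    show "(p2 \<cdot> c) \<cdot> d \<in> hom C E X" using typing by (auto simp: arrow_simps)
    have "((p2 \<cdot> c) \<cdot> d) \<cdot> ?n = p2 \<cdot> (e \<cdot> (b \<cdot> ?n))"
      using typing n(1) Comp_eq_extend[OF bd(3)] by (simp add: arrow_simps)
    also have "\<dots> = f"
      using typing YX Comp_eq_extend[OF sr(2)] by (simp add: n(2) arrow_simps)
    finally show "((p2 \<cdot> c) \<cdot> d) \<cdot> ?n = f" .
  qed
qed

text \<open>
  Being split by a map only up to a weak equivalence suffices for a fibration to have a section:
  replacing \<open>m\<close> by the fibration \<open>e\<close> of its factorisation makes \<open>\<phi> \<cdot> e\<close> an acyclic fibration.
\<close>

lemma fibration_section:
  assumes "\<phi> \<in> F" "\<phi> \<in> hom C Q X" "m \<in> hom C E Q" "\<phi> \<cdot> m \<in> W"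
  obtains \<sigma> where "\<sigma> \<in> hom C X Q" "\<phi> \<cdot> \<sigma> = Id C X"
proof -
  obtain N n e where n: "n \<in> W" "n \<in> hom C E N" and e: "e \<in> F" "e \<in> hom C N Q" "e \<cdot> n = m"
    using factorisation[OF assms(3)] .
  have \<phi>e: "\<phi> \<cdot> e \<in> hom C N X" "\<phi> \<cdot> e \<in> F"
    using assms e Comp_F[OF e(1) assms(1)] by (auto simp: arrow_simps)
  have "\<phi> \<cdot> e \<in> W"
    by (rule W_cancel_right[OF n(2) \<phi>e(1) n(1)]) (use assms n e in \<open>simp add: arrow_simps\<close>)
  then obtain \<sigma> where "\<sigma> \<in> hom C X N" "(\<phi> \<cdot> e) \<cdot> \<sigma> = Id C X"
    using acyclic_section[of "\<phi> \<cdot> e"] \<phi>e by (auto simp: hom_def)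
  then show ?thesis using that[of "e \<cdot> \<sigma>"] assms e by (auto simp: arrow_simps)
qed


section \<open>Fibrewise path objects\<close>

text \<open>
  The choice of a cone \<open>A \<times>\<^sub>I A\<close> is immaterial by \<open>pullback_cone_iso\<close>, so the same \<open>r, s, t\<close> can be
  required to work for all cones. That \<open>r\<close> is a weak equivalence takes the place of an elimination rule:
  the latter refers to the path objects of all fibrations at once, the former to a single one.
\<close>

definition fibrewise_path_object :: "'m \<Rightarrow> 'm \<Rightarrow> 'm \<Rightarrow> 'm \<Rightarrow> bool" where
  "fibrewise_path_object p r s t \<longleftrightarrow> r \<in> W \<and>
     (\<forall>\<pi>1 \<pi>2. pullback C p p \<pi>1 \<pi>2 \<longrightarrow> factors_diagonal C F \<pi>1 \<pi>2 r s t)"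

lemma fibrewise_path_object_exists:
  assumes "p \<in> F" shows "\<exists>r s t. fibrewise_path_object p r s t"
proof -
  define A I where "A = Dom C p" and "I = Cod C p"
  have p: "p \<in> hom C A I" using F_subset assms by (auto simp: hom_def A_def I_def)
  obtain X \<pi>1 \<pi>2 where pb: "pullback C p p \<pi>1 \<pi>2" and \<pi>: "\<pi>1 \<in> hom C X A" "\<pi>2 \<in> hom C X A"
    using fibration_pullback[OF assms p p] .
  have IdA: "Id C A \<in> hom C A A" using Id_in_hom hom_Dom_Ob[OF p] .
  note \<delta> = pullback_induced[OF pb \<pi> IdA IdA refl]
  obtain P r e where r: "r \<in> W" "r \<in> hom C A P" and e: "e \<in> F" "e \<in> hom C P X"
    and er: "e \<cdot> r = induced C \<pi>1 \<pi>2 (Id C A) (Id C A)"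
    using factorisation[OF \<delta>(1)] .
  have "factors_diagonal C F \<rho>1 \<rho>2 r (\<pi>1 \<cdot> e) (\<pi>2 \<cdot> e)" if pb': "pullback C p p \<rho>1 \<rho>2" for \<rho>1 \<rho>2
  proof -
    obtain Y where \<rho>: "\<rho>1 \<in> hom C Y A" "\<rho>2 \<in> hom C Y A" using pullback_homs[OF pb' p p] .
    obtain \<phi> where \<phi>: "\<phi> \<in> hom C X Y" "iso C \<phi>" "\<rho>1 \<cdot> \<phi> = \<pi>1" "\<rho>2 \<cdot> \<phi> = \<pi>2"
      using pullback_cone_iso[OF pb pb' \<pi> \<rho>] .
    note typing = \<pi> \<rho> \<phi>(1) r(2) e(2)
    have \<phi>er: "\<phi> \<cdot> (e \<cdot> r) \<in> hom C A Y" using typing by (auto simp: arrow_simps)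
    have "diagonal C \<rho>1 \<rho>2 = \<phi> \<cdot> (e \<cdot> r)"
      unfolding diagonal_def
      by (rule induced_eqI[OF pb' \<rho> \<phi>er])
        (use typing \<delta> Comp_eq_extend[OF \<phi>(3)] Comp_eq_extend[OF \<phi>(4)] in \<open>simp_all add: arrow_simps er\<close>)
    moreover have "\<phi> \<cdot> e \<in> F" by (rule Comp_F[OF e(1) iso_F[OF \<phi>(2)]]) (use typing in \<open>auto simp: hom_def\<close>)
    moreover have "\<rho>1 \<cdot> (\<phi> \<cdot> e) = \<pi>1 \<cdot> e" "\<rho>2 \<cdot> (\<phi> \<cdot> e) = \<pi>2 \<cdot> e"
      using typing Comp_eq_extend[OF \<phi>(3)] Comp_eq_extend[OF \<phi>(4)] by (auto simp: arrow_simps)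
    ultimately show ?thesis
      unfolding factors_diagonal_def using typing
      by (auto simp: arrow_simps intro!: bexI[of _ "\<phi> \<cdot> e"])
  qed
  then show ?thesis using r(1) unfolding fibrewise_path_object_def by blast
qed

text \<open>
  As one-sided inverses of the weak equivalence \<open>r\<close>, both \<open>s\<close> and \<open>t\<close> are weak equivalences; and \<open>s\<close> is
  a fibration because it is \<open>(s, t)\<close> followed by the projection \<open>A \<times>\<^sub>I A \<rightarrow> A\<close>.
\<close>

lemma fibrewise_path_object_cone:
  assumes "fibrewise_path_object p r s t" "pullback C p p \<pi>1 \<pi>2" "p \<in> F" "p \<in> hom C A I"
    "\<pi>1 \<in> hom C X A" "\<pi>2 \<in> hom C X A"
  obtains P e where "r \<in> W" "r \<in> hom C A P" "s \<in> hom C P A" "t \<in> hom C P A" "s \<cdot> r = Id C A"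
    "t \<cdot> r = Id C A" "p \<cdot> s = p \<cdot> t" "s \<in> W \<inter> F" "t \<in> W" "e \<in> F" "e \<in> hom C P X" "\<pi>1 \<cdot> e = s"
    "\<pi>2 \<cdot> e = t"
proof -
  have rW: "r \<in> W" and fac: "factors_diagonal C F \<pi>1 \<pi>2 r s t"
    using assms(1,2) by (auto simp: fibrewise_path_object_def)
  define P where "P = Cod C r"
  have r: "r \<in> hom C A P"
    using fac assms(5) by (auto simp: factors_diagonal_def hom_def P_def)
  obtain e where e: "e \<in> F" "e \<in> hom C P X" "\<pi>1 \<cdot> e = s" "\<pi>2 \<cdot> e = t" "e \<cdot> r = diagonal C \<pi>1 \<pi>2"
    using fac assms(5) unfolding factors_diagonal_def P_def by (auto simp: hom_def)
  have IdA: "Id C A \<in> hom C A A" using Id_in_hom hom_Dom_Ob[OF assms(4)] .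
  note \<delta> = pullback_induced[OF assms(2,5,6) IdA IdA refl]
  have dia: "diagonal C \<pi>1 \<pi>2 = induced C \<pi>1 \<pi>2 (Id C A) (Id C A)"
    using assms(5) by (simp add: diagonal_def hom_def)
  have st: "s \<in> hom C P A" "t \<in> hom C P A"
    using assms(5,6) e(2) by (auto simp: arrow_simps simp flip: e(3,4))
  have sr: "s \<cdot> r = Id C A" "t \<cdot> r = Id C A"
    using \<delta> assms(5,6) e(2) r
    by (auto simp: arrow_simps dia e(5) simp flip: e(3,4))
  have "p \<cdot> \<pi>1 = p \<cdot> \<pi>2" using assms(2) by (auto simp: pullback_def)
  then have ps: "p \<cdot> s = p \<cdot> t"
    using assms(4-6) e(2) by (simp add: arrow_simps flip: e(3,4) Comp_assoc_Mor)
  have "\<pi>1 \<in> F" using pullback_F[OF assms(3) pullback_sym[OF assms(2)]] .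
  then have sF: "s \<in> F" using Comp_F[OF e(1), of \<pi>1] e assms(5) by (auto simp: hom_def)
  show ?thesis
    using that[of P e] rW r st sr ps sF e(1-4) retraction_W[OF r st(1) rW sr(1)]
      retraction_W[OF r st(2) rW sr(2)] by blast
qed

lemma fibrewise_path_object_homs:
  assumes "fibrewise_path_object p r s t" "p \<in> F" "p \<in> hom C A I"
  obtains P where "r \<in> W" "r \<in> hom C A P" "s \<in> hom C P A" "t \<in> hom C P A" "s \<cdot> r = Id C A"
    "t \<cdot> r = Id C A" "p \<cdot> s = p \<cdot> t" "s \<in> W \<inter> F" "t \<in> W"
  using fibration_pullback[OF assms(2,3,3)] fibrewise_path_object_cone[OF assms(1) _ assms(2,3)]
  by metis


section \<open>Lifting weak equivalences against fibrations\<close>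

text \<open>
  Factor \<open>(k, g) : V \<rightarrow> B \<times>\<^sub>A U\<close> as a weak equivalence \<open>j : V \<rightarrow> E\<close> followed by a fibration, with
  components \<open>e : E \<rightarrow> B\<close> and \<open>a : E \<rightarrow> U\<close>. Then \<open>a\<close> is a fibration and, as \<open>a \<cdot> j = g\<close>, acyclic. For a
  section \<open>\<sigma>\<close> of \<open>a\<close> the filler is \<open>e \<cdot> \<sigma>\<close>. After \<open>g\<close> it is \<open>e \<cdot> \<sigma> \<cdot> a \<cdot> j\<close>, whereas \<open>k = e \<cdot> j\<close>, so it
  remains to find a homotopy on \<open>E\<close> from \<open>e \<cdot> \<sigma> \<cdot> a\<close> to \<open>e\<close>. Such homotopies are the sections of a fibration
  \<open>\<phi> : Q \<rightarrow> E\<close>, and over the weak equivalence \<open>\<sigma>\<close> there is a constant one since \<open>a \<cdot> \<sigma>\<close> is the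
  identity; hence \<open>fibration_section\<close> applies.
\<close>

theorem weak_equivalence_lifting:
  assumes path: "fibrewise_path_object f r s t" and fF: "f \<in> F" and f: "f \<in> hom C B A"
    and gW: "g \<in> W" and g: "g \<in> hom C V U" and k: "k \<in> hom C V B" and l: "l \<in> hom C U A"
    and sq: "f \<cdot> k = l \<cdot> g"
  obtains d H where "d \<in> hom C U B" "H \<in> hom C V (Cod C r)" "f \<cdot> d = l" "s \<cdot> H = d \<cdot> g" "t \<cdot> H = k"
proof -
  obtain B' b1 b2 where pbb: "pullback C f l b1 b2" and b: "b1 \<in> hom C B' B" "b2 \<in> hom C B' U"
    "f \<cdot> b1 = l \<cdot> b2" and b2F: "b2 \<in> F" using fibration_pullback[OF fF f l] .
  note k' = pullback_induced[OF pbb b(1,2) k g sq]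
  obtain E j e0 where jW: "j \<in> W" and j: "j \<in> hom C V E" and e0F: "e0 \<in> F" and e0: "e0 \<in> hom C E B'"
    and e0j: "e0 \<cdot> j = induced C b1 b2 k g" using factorisation[OF k'(1)] .
  define a where "a = b2 \<cdot> e0"
  define e where "e = b1 \<cdot> e0"
  have a: "a \<in> hom C E U" and e: "e \<in> hom C E B"
    using b e0 by (auto simp: a_def e_def arrow_simps)
  have aj: "a \<cdot> j = g" and ej: "e \<cdot> j = k"
    using b e0 j k' e0j by (auto simp: a_def e_def arrow_simps)
  have fe: "f \<cdot> e = l \<cdot> a"
    using b e0 f l Comp_eq_extend[OF b(3)] by (simp add: a_def e_def arrow_simps)
  have aF: "a \<in> F" unfolding a_def by (rule Comp_F[OF e0F b2F]) (use b e0 in \<open>auto simp: hom_def\<close>)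
  have aW: "a \<in> W" using W_cancel_right[OF j a jW] aj gW by simp
  obtain \<sigma> where \<sigma>: "\<sigma> \<in> hom C U E" "a \<cdot> \<sigma> = Id C U"
    using acyclic_section[of a] aF aW a by (auto simp: hom_def)
  have \<sigma>W: "\<sigma> \<in> W" using section_W[OF \<sigma>(1) a aW \<sigma>(2)] .
  obtain X \<pi>1 \<pi>2 where pb: "pullback C f f \<pi>1 \<pi>2" and \<pi>: "\<pi>1 \<in> hom C X B" "\<pi>2 \<in> hom C X B"
    using fibration_pullback[OF fF f f] .
  obtain P \<epsilon> where r: "r \<in> W" "r \<in> hom C B P" and st: "s \<in> hom C P B" "t \<in> hom C P B"
    and sr: "s \<cdot> r = Id C B" "t \<cdot> r = Id C B"
    and \<epsilon>: "\<epsilon> \<in> F" "\<epsilon> \<in> hom C P X" "\<pi>1 \<cdot> \<epsilon> = s" "\<pi>2 \<cdot> \<epsilon> = t"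
    using fibrewise_path_object_cone[OF path pb fF f \<pi>] by metis
  have Ob: "B \<in> Ob C" "U \<in> Ob C" "E \<in> Ob C" using hom_Ob e a by auto
  note typing = f l g k a e j \<sigma>(1) \<pi> r(2) st \<epsilon>(2)
  have feo: "f \<cdot> (e \<cdot> (\<sigma> \<cdot> a)) = f \<cdot> e"
  proof -
    have "f \<cdot> (e \<cdot> (\<sigma> \<cdot> a)) = l \<cdot> (a \<cdot> (\<sigma> \<cdot> a))"
      using typing Comp_eq_extend[OF fe] by (simp add: arrow_simps)
    also have "\<dots> = l \<cdot> a" using typing Ob Comp_eq_extend[OF \<sigma>(2)] by (simp add: arrow_simps)
    finally show ?thesis by (simp add: fe)
  qed
  have e\<sigma>a: "e \<cdot> (\<sigma> \<cdot> a) \<in> hom C E B" using typing by (auto simp: arrow_simps)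
  note c = pullback_induced[OF pb \<pi> e\<sigma>a e feo]
  let ?c = "induced C \<pi>1 \<pi>2 (e \<cdot> (\<sigma> \<cdot> a)) e"
  \<comment> \<open>\<open>Q\<close> consists of the points of \<open>E\<close> with a path in \<open>P\<close> between their images under \<open>e \<cdot> \<sigma> \<cdot> a\<close> and \<open>e\<close>.\<close>
  obtain Q x \<phi> where pbQ: "pullback C \<epsilon> ?c x \<phi>" and Q: "x \<in> hom C Q P" "\<phi> \<in> hom C Q E"
    "\<epsilon> \<cdot> x = ?c \<cdot> \<phi>" and \<phi>F: "\<phi> \<in> F" using fibration_pullback[OF \<epsilon>(1,2) c(1)] .
  have re\<sigma>: "r \<cdot> (e \<cdot> \<sigma>) \<in> hom C U P" using typing by (auto simp: arrow_simps)
  have const: "\<epsilon> \<cdot> (r \<cdot> (e \<cdot> \<sigma>)) = ?c \<cdot> \<sigma>"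
  proof (rule pullback_cancel[OF pb \<pi>])
    show "\<pi>1 \<cdot> (\<epsilon> \<cdot> (r \<cdot> (e \<cdot> \<sigma>))) = \<pi>1 \<cdot> (?c \<cdot> \<sigma>)"
      using typing c(1) Ob Comp_eq_extend[OF \<epsilon>(3)] Comp_eq_extend[OF sr(1)] Comp_eq_extend[OF c(2)]
      by (simp add: arrow_simps \<sigma>(2))
    show "\<pi>2 \<cdot> (\<epsilon> \<cdot> (r \<cdot> (e \<cdot> \<sigma>))) = \<pi>2 \<cdot> (?c \<cdot> \<sigma>)"
      using typing c(1) Ob Comp_eq_extend[OF \<epsilon>(4)] Comp_eq_extend[OF sr(2)] Comp_eq_extend[OF c(3)]
      by (simp add: arrow_simps)
  qed (use typing c(1) in \<open>auto simp: arrow_simps\<close>)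
  note m = pullback_induced[OF pbQ Q(1,2) re\<sigma> \<sigma>(1) const]
  obtain \<tau> where \<tau>: "\<tau> \<in> hom C E Q" "\<phi> \<cdot> \<tau> = Id C E"
    using fibration_section[OF \<phi>F Q(2) m(1)] m(3) \<sigma>W by auto
  have \<epsilon>x: "\<epsilon> \<cdot> (x \<cdot> \<tau>) = ?c"
    using typing Q c(1) \<tau> Ob Comp_eq_extend[OF Q(3)] by (simp add: arrow_simps)
  have h: "s \<cdot> (x \<cdot> \<tau>) = e \<cdot> (\<sigma> \<cdot> a)" "t \<cdot> (x \<cdot> \<tau>) = e"
    using typing Q \<tau> c by (auto simp: arrow_simps \<epsilon>x simp flip: \<epsilon>(3,4))
  show ?thesis
  proof (rule that)
    show "e \<cdot> \<sigma> \<in> hom C U B" using typing by (auto simp: arrow_simps)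
    show "x \<cdot> (\<tau> \<cdot> j) \<in> hom C V (Cod C r)" using typing Q \<tau> by (auto simp: arrow_simps)
    show "f \<cdot> (e \<cdot> \<sigma>) = l"
      using typing \<sigma> Comp_eq_extend[OF fe] by (simp add: arrow_simps)
    show "s \<cdot> (x \<cdot> (\<tau> \<cdot> j)) = (e \<cdot> \<sigma>) \<cdot> g"
      using typing Q \<tau> Comp_eq_extend[OF h(1)] by (simp add: arrow_simps aj)
    show "t \<cdot> (x \<cdot> (\<tau> \<cdot> j)) = k"
      using typing Q \<tau> Comp_eq_extend[OF h(2)] by (simp add: arrow_simps ej)
  qed
qed

text \<open>
  When two factorisations of one map are compared, only the lower triangle matters.
\<close>

corollary weak_equivalence_lift:
  assumes "f \<in> F" "f \<in> hom C B A" "g \<in> W" "g \<in> hom C V U" "k \<in> hom C V B" "l \<in> hom C U A"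
    "f \<cdot> k = l \<cdot> g"
  shows "\<exists>d \<in> hom C U B. f \<cdot> d = l"
  using fibrewise_path_object_exists[OF assms(1)] weak_equivalence_lifting[OF _ assms] by metis


section \<open>Pulling back reflexivity maps along fibrations\<close>

text \<open>
  Think of \<open>u\<close> as a family over \<open>Z\<close>, so that \<open>g\<close> includes its restriction \<open>V\<close> to \<open>Y\<close>. Since \<open>v\<close> is
  acyclic, points of \<open>Z\<close> with the same image under \<open>v\<close> are connected in an essentially unique way, and
  the family can be transported between them. With \<open>M\<close> the object of pairs of \<open>e\<close> in \<open>U\<close> and \<open>z\<close> in \<open>Z\<close>
  with \<open>v (u e) = v z\<close>, the transport \<open>T : M \<rightarrow> U\<close> comes from lifting \<open>m : e \<mapsto> (e, u e)\<close>, a section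
  of the acyclic fibration \<open>M \<rightarrow> U\<close>, against \<open>u\<close>; so \<open>T \<cdot> m\<close> is fibrewise homotopic to the identity and
  \<open>T\<close> is a weak equivalence.

  Transporting each \<open>e\<close> to the fibre over \<open>w (v (u e))\<close> is a map \<open>\<rho> : U \<rightarrow> V\<close>. Here \<open>g \<cdot> \<rho>\<close> is \<open>T\<close> after
  another section \<open>n\<close> of \<open>M \<rightarrow> U\<close>, hence a weak equivalence. On \<open>V\<close> the sections \<open>m\<close> and \<open>n\<close> agree, so
  \<open>\<rho> \<cdot> g\<close> is the restriction of \<open>T \<cdot> m\<close> and, the homotopy being fibrewise, homotopic to the identity.
  The 2-out-of-6 property for \<open>g, \<rho>, g\<close> then gives the claim.
\<close>

theorem section_pullback_W:
  assumes vWF: "v \<in> W \<inter> F" and v: "v \<in> hom C Z Y" and w: "w \<in> hom C Y Z" and vw: "v \<cdot> w = Id C Y"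
    and uF: "u \<in> F" and u: "u \<in> hom C U Z" and pb: "pullback C w u y g"
  shows "g \<in> W"
proof -
  obtain V where y: "y \<in> hom C V Y" and g: "g \<in> hom C V U" and wy: "w \<cdot> y = u \<cdot> g"
    using pullback_homs[OF pb w u] .
  have Ob: "Y \<in> Ob C" "Z \<in> Ob C" "U \<in> Ob C" "V \<in> Ob C" using hom_Ob v g by auto
  obtain r s t where path: "fibrewise_path_object u r s t"
    using fibrewise_path_object_exists[OF uF] by blast
  obtain P where rW: "r \<in> W" and r: "r \<in> hom C U P" and s: "s \<in> hom C P U" and t: "t \<in> hom C P U"
    and sr: "s \<cdot> r = Id C U" and tr: "t \<cdot> r = Id C U" and us: "u \<cdot> s = u \<cdot> t"
    and sWF: "s \<in> W \<inter> F" and tW: "t \<in> W"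
    using fibrewise_path_object_homs[OF path uF u] .
  note typing = v w u y g r s t
  have vu: "v \<cdot> u \<in> hom C U Y" using typing by (auto simp: arrow_simps)
  obtain M l x where pbM: "pullback C v (v \<cdot> u) l x" and l: "l \<in> hom C M Z" and x: "x \<in> hom C M U"
    using fibration_pullback[OF _ v vu] vWF by blast
  have xW: "x \<in> W" using pullback_acyclic[OF vWF pbM] by blast
  have IdU: "Id C U \<in> hom C U U" using Id_in_hom Ob by blast
  have "v \<cdot> u = (v \<cdot> u) \<cdot> Id C U" using Comp_Id_right[OF vu] by simp
  note m = pullback_induced[OF pbM l x u IdU this]
  let ?m = "induced C l x u (Id C U)"
  have mW: "?m \<in> W" using section_W[OF m(1) x xW m(3)] .
  have "u \<cdot> Id C U = l \<cdot> ?m" using m(2) Comp_Id_right[OF u] by simp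
  from weak_equivalence_lifting[OF path uF u mW m(1) IdU l this]
  obtain T H where T: "T \<in> hom C M U" and H: "H \<in> hom C U P" and uT: "u \<cdot> T = l"
    and sH: "s \<cdot> H = T \<cdot> ?m" and tH: "t \<cdot> H = Id C U"
    using r by (auto simp: hom_def)
  have "T \<cdot> ?m \<in> W"
    using W_Comp[OF H s section_W[OF H t tW tH]] sWF sH by simp
  then have TW: "T \<in> W" using W_cancel_right[OF m(1) T mW] by blast
  have wvu: "w \<cdot> (v \<cdot> u) \<in> hom C U Z" "v \<cdot> (w \<cdot> (v \<cdot> u)) = (v \<cdot> u) \<cdot> Id C U"
    using typing Ob Comp_eq_extend[OF vw] by (auto simp: arrow_simps)
  note n = pullback_induced[OF pbM l x wvu(1) IdU wvu(2)]
  let ?n = "induced C l x (w \<cdot> (v \<cdot> u)) (Id C U)"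
  have nW: "?n \<in> W" using section_W[OF n(1) x xW n(3)] .
  have TnW: "T \<cdot> ?n \<in> W" using W_Comp[OF n(1) T nW TW] .
  have Tn: "T \<cdot> ?n \<in> hom C U U" "w \<cdot> (v \<cdot> u) = u \<cdot> (T \<cdot> ?n)"
    using typing T n(1) Comp_eq_extend[OF uT] by (auto simp: arrow_simps n(2))
  note \<rho> = pullback_induced[OF pb y g vu Tn]
  let ?\<rho> = "induced C y g (v \<cdot> u) (T \<cdot> ?n)"
  have "?\<rho> \<cdot> g \<in> W"
  proof -
    have "?n \<cdot> g = ?m \<cdot> g"
    proof (rule pullback_cancel[OF pbM l x])
      have "l \<cdot> (?n \<cdot> g) = w \<cdot> (v \<cdot> (w \<cdot> y))"
        using typing l n(1) Comp_eq_extend[OF n(2)] by (simp add: arrow_simps wy)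
      also have "\<dots> = u \<cdot> g"
        using typing Ob Comp_eq_extend[OF vw] by (simp add: arrow_simps flip: wy)
      also have "\<dots> = l \<cdot> (?m \<cdot> g)"
        using typing l m(1) Comp_eq_extend[OF m(2)] by (simp add: arrow_simps)
      finally show "l \<cdot> (?n \<cdot> g) = l \<cdot> (?m \<cdot> g)" .
      show "x \<cdot> (?n \<cdot> g) = x \<cdot> (?m \<cdot> g)"
        using typing x m(1) n(1) Comp_eq_extend[OF m(3)] Comp_eq_extend[OF n(3)]
        by (simp add: arrow_simps)
    qed (use typing m(1) n(1) in \<open>auto simp: arrow_simps\<close>)
    note ng = this
    \<comment> \<open>
      \<open>P'\<close> is the restriction of \<open>P\<close> to \<open>Y\<close>, a path object for \<open>V\<close> over \<open>Y\<close>. Taking it as the pullback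
      of \<open>s\<close> along \<open>g\<close> makes it immediate that \<open>s'\<close> is an acyclic fibration.
    \<close>
    obtain P' i s' where pbP: "pullback C s g i s'" and i: "i \<in> hom C P' P" and s': "s' \<in> hom C P' V"
      and si: "s \<cdot> i = g \<cdot> s'"
      using fibration_pullback[OF _ s g] sWF by blast
    have s'W: "s' \<in> W" using pullback_acyclic[OF sWF pbP] by blast
    have ti: "y \<cdot> s' \<in> hom C P' Y" "t \<cdot> i \<in> hom C P' U" "w \<cdot> (y \<cdot> s') = u \<cdot> (t \<cdot> i)"
    proof -
      have "w \<cdot> (y \<cdot> s') = u \<cdot> (g \<cdot> s')"
        using typing s' Comp_eq_extend[OF wy] by (simp add: arrow_simps)
      also have "\<dots> = u \<cdot> (t \<cdot> i)"
        using typing i Comp_eq_extend[OF us] by (simp add: arrow_simps flip: si)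
      finally show "w \<cdot> (y \<cdot> s') = u \<cdot> (t \<cdot> i)" .
    qed (use typing i s' in \<open>auto simp: arrow_simps\<close>)
    note t' = pullback_induced[OF pb y g ti]
    let ?t' = "induced C y g (y \<cdot> s') (t \<cdot> i)"
    have IdV: "Id C V \<in> hom C V V" using Id_in_hom Ob by blast
    have rg: "r \<cdot> g \<in> hom C V P" "s \<cdot> (r \<cdot> g) = g \<cdot> Id C V"
      using typing Ob Comp_eq_extend[OF sr] by (auto simp: arrow_simps)
    note r' = pullback_induced[OF pbP i s' rg(1) IdV rg(2)]
    let ?r' = "induced C i s' (r \<cdot> g) (Id C V)"
    have r'W: "?r' \<in> W" using section_W[OF r'(1) s' s'W r'(3)] .
    have "?t' \<cdot> ?r' = Id C V"
      by (rule pullback_cancel[OF pb y g])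
        (use typing i s' t'(1) r'(1) Ob Comp_eq_extend[OF t'(2)] Comp_eq_extend[OF t'(3)]
          Comp_eq_extend[OF tr] in \<open>simp_all add: arrow_simps r'(2,3)\<close>)
    then have t'W: "?t' \<in> W" using retraction_W[OF r'(1) t'(1) r'W] by blast
    \<comment> \<open>The restriction \<open>H'\<close> of \<open>H\<close> is a homotopy from \<open>\<rho> \<cdot> g\<close> to the identity of \<open>V\<close>.\<close>
    have Hg: "H \<cdot> g \<in> hom C V P" "?\<rho> \<cdot> g \<in> hom C V V" "s \<cdot> (H \<cdot> g) = g \<cdot> (?\<rho> \<cdot> g)"
      using typing H T m(1) n(1) \<rho>(1) Comp_eq_extend[OF sH] Comp_eq_extend[OF \<rho>(3)]
      by (auto simp: arrow_simps ng)
    note H' = pullback_induced[OF pbP i s' Hg]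
    let ?H' = "induced C i s' (H \<cdot> g) (?\<rho> \<cdot> g)"
    have "?t' \<cdot> ?H' = Id C V"
    proof (rule pullback_cancel[OF pb y g])
      have "y \<cdot> (?t' \<cdot> ?H') = y \<cdot> (?\<rho> \<cdot> g)"
        using typing i s' t'(1) H'(1) Comp_eq_extend[OF t'(2)] by (simp add: arrow_simps H'(3))
      also have "\<dots> = v \<cdot> (w \<cdot> y)"
        using typing \<rho>(1) Comp_eq_extend[OF \<rho>(2)] by (simp add: arrow_simps wy)
      also have "\<dots> = y" using typing Ob Comp_eq_extend[OF vw] by (simp add: arrow_simps)
      finally show "y \<cdot> (?t' \<cdot> ?H') = y \<cdot> Id C V" using Comp_Id_right[OF y] by simp
      show "g \<cdot> (?t' \<cdot> ?H') = g \<cdot> Id C V"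
        using typing i H t'(1) H'(1) Ob Comp_eq_extend[OF t'(3)] Comp_eq_extend[OF tH]
        by (simp add: arrow_simps H'(2))
    qed (use typing t'(1) H'(1) Ob in \<open>auto simp: arrow_simps\<close>)
    then have "?H' \<in> W" using section_W[OF H'(1) t'(1) t'W] by blast
    then show ?thesis using W_Comp[OF H'(1) s' _ s'W] H'(3) by simp
  qed
  then show "g \<in> W" using two_out_of_six[OF g \<rho>(1) g] TnW \<rho>(3) by simp
qed

lemma path_object_elimination:
  assumes path_p: "fibrewise_path_object p rp sp tp" and pF: "p \<in> F"
    and path_f: "fibrewise_path_object f rf sf tf" and fF: "f \<in> F"
    and uF: "u \<in> F" and pb: "pullback C rp u v g"
    and k: "k \<in> hom C (Dom C g) (Dom C f)" and l: "l \<in> hom C (Cod C g) (Cod C f)"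
    and sq: "f \<cdot> k = l \<cdot> g"
  shows "\<exists>d \<in> hom C (Cod C g) (Dom C f). \<exists>H \<in> hom C (Dom C g) (Cod C rf).
    f \<cdot> d = l \<and> sf \<cdot> H = d \<cdot> g \<and> tf \<cdot> H = k"
proof -
  have p: "p \<in> hom C (Dom C p) (Cod C p)" and f: "f \<in> hom C (Dom C f) (Cod C f)"
    using pF fF F_subset by (auto simp: hom_def)
  obtain P where r: "rp \<in> hom C (Dom C p) P" and s: "sp \<in> hom C P (Dom C p)"
    and sr: "sp \<cdot> rp = Id C (Dom C p)" and sWF: "sp \<in> W \<inter> F"
    using fibrewise_path_object_homs[OF path_p pF p] .
  have u: "u \<in> hom C (Dom C u) P" using pb r by (auto simp: pullback_def hom_def)
  have gW: "g \<in> W" using section_pullback_W[OF sWF s r sr uF u pb] .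
  then have g: "g \<in> hom C (Dom C g) (Cod C g)" using W_subset by (auto simp: hom_def)
  show ?thesis using weak_equivalence_lifting[OF path_f fF f gW g k l sq] by metis
qed


section \<open>Stability of path objects under pullback\<close>

text \<open>
  The apex of \<open>b, w\<close> is \<open>k\<^sup>*(P\<^sub>I A)\<close>, and \<open>e\<close> is its map to \<open>k\<^sup>*A \<times>\<^sub>J k\<^sup>*A\<close>, described by its components
  rather than through the canonical isomorphism with \<open>k\<^sup>*(A \<times>\<^sub>I A)\<close>. It is a fibration because it is the
  pullback of \<open>(s, t)\<close> along \<open>a \<times> a : k\<^sup>*A \<times>\<^sub>J k\<^sup>*A \<rightarrow> A \<times>\<^sub>I A\<close>. The restriction of \<open>r\<close>, a map
  \<open>k\<^sup>*A \<rightarrow> k\<^sup>*(P\<^sub>I A)\<close>, is a weak equivalence because it is a section of \<open>\<rho>1 \<cdot> e\<close>, a pullback of the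
  acyclic fibration \<open>s\<close>. So \<open>k\<^sup>*(P\<^sub>I A)\<close> and \<open>P\<^sub>J(k\<^sup>*A)\<close> both factor the diagonal of \<open>k\<^sup>*A\<close> as a weak
  equivalence followed by a fibration, and lifting each against the other gives the two comparison maps.
\<close>

lemma path_object_pullback:
  assumes path_p: "fibrewise_path_object p r s t" and pF: "p \<in> F" and p: "p \<in> hom C A I"
    and k: "k \<in> hom C J I"
    and pb\<pi>: "pullback C p p \<pi>1 \<pi>2" and \<pi>: "\<pi>1 \<in> hom C X A" "\<pi>2 \<in> hom C X A"
    and pba: "pullback C p k a q" and a: "a \<in> hom C A' A" and q: "q \<in> hom C A' J"
    and path_q: "fibrewise_path_object q r' s' t'"
    and pb\<rho>: "pullback C q q \<rho>1 \<rho>2" and \<rho>: "\<rho>1 \<in> hom C X' A'" "\<rho>2 \<in> hom C X' A'"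
    and pbb: "pullback C (p \<cdot> s) k b w" and e: "e \<in> hom C (Dom C b) X'"
    and ae: "a \<cdot> (\<rho>1 \<cdot> e) = s \<cdot> b" "a \<cdot> (\<rho>2 \<cdot> e) = t \<cdot> b" and qe: "q \<cdot> (\<rho>1 \<cdot> e) = w"
    and \<epsilon>': "\<epsilon>' \<in> F" "\<epsilon>' \<in> hom C (Cod C r') X'" "\<rho>1 \<cdot> \<epsilon>' = s'" "\<rho>2 \<cdot> \<epsilon>' = t'"
  shows "(\<exists>m \<in> hom C (Cod C r') (Dom C b). e \<cdot> m = \<epsilon>') \<and>
    (\<exists>n \<in> hom C (Dom C b) (Cod C r'). \<epsilon>' \<cdot> n = e)"
proof -
  obtain P \<epsilon> where r: "r \<in> hom C A P" and s: "s \<in> hom C P A" and t: "t \<in> hom C P A"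
    and sr: "s \<cdot> r = Id C A" and tr: "t \<cdot> r = Id C A" and sWF: "s \<in> W \<inter> F"
    and \<epsilon>F: "\<epsilon> \<in> F" and \<epsilon>: "\<epsilon> \<in> hom C P X" and \<pi>\<epsilon>: "\<pi>1 \<cdot> \<epsilon> = s" "\<pi>2 \<cdot> \<epsilon> = t"
    using fibrewise_path_object_cone[OF path_p pb\<pi> pF p \<pi>] by metis
  have pa: "p \<cdot> a = k \<cdot> q" using pba by (auto simp: pullback_def)
  have qF: "q \<in> F" using pullback_F[OF pF pba] .
  have q\<rho>: "q \<cdot> \<rho>1 = q \<cdot> \<rho>2" using pb\<rho> by (auto simp: pullback_def)
  have r'W: "r' \<in> W" and r': "r' \<in> hom C A' (Cod C r')"
    and s'r': "s' \<cdot> r' = Id C A'" and t'r': "t' \<cdot> r' = Id C A'"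
    using fibrewise_path_object_homs[OF path_q qF q] by (auto simp: hom_def)
  have ps: "p \<cdot> s \<in> hom C P I" using p s by (auto simp: arrow_simps)
  obtain K where b: "b \<in> hom C K P" and w: "w \<in> hom C K J"
    using pullback_homs[OF pbb ps k] .
  have K: "Dom C b = K" using b by (simp add: hom_def)
  note e = e[unfolded K]
  note typing = p k \<pi> a q \<rho> e \<epsilon>'(2) r s t \<epsilon> r' b w
  have Ob: "A \<in> Ob C" "A' \<in> Ob C" using hom_Ob a by auto
  have \<rho>e: "\<rho>1 \<cdot> e \<in> hom C K A'" "\<rho>2 \<cdot> e \<in> hom C K A'"
    using typing by (auto simp: arrow_simps)
  have qe2: "q \<cdot> (\<rho>2 \<cdot> e) = w"
    using typing Comp_eq_extend[OF q\<rho>] by (simp add: arrow_simps flip: qe)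

  \<comment> \<open>\<open>\<alpha>\<close> is \<open>a \<times> a\<close>.\<close>
  have a\<rho>: "a \<cdot> \<rho>1 \<in> hom C X' A" "a \<cdot> \<rho>2 \<in> hom C X' A" "p \<cdot> (a \<cdot> \<rho>1) = p \<cdot> (a \<cdot> \<rho>2)"
    using typing Comp_eq_extend[OF pa] by (auto simp: arrow_simps q\<rho>)
  note \<alpha> = pullback_induced[OF pb\<pi> \<pi> a\<rho>]
  let ?\<alpha> = "induced C \<pi>1 \<pi>2 (a \<cdot> \<rho>1) (a \<cdot> \<rho>2)"
  have "pullback C \<epsilon> ?\<alpha> b e"
  proof (rule pullbackI[OF \<epsilon> \<alpha>(1) b e])
    show "\<epsilon> \<cdot> b = ?\<alpha> \<cdot> e"
      by (rule pullback_cancel[OF pb\<pi> \<pi>])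
        (use typing \<alpha>(1) Comp_eq_extend[OF \<pi>\<epsilon>(1)] Comp_eq_extend[OF \<pi>\<epsilon>(2)]
          Comp_eq_extend[OF \<alpha>(2)] Comp_eq_extend[OF \<alpha>(3)] ae in \<open>simp_all add: arrow_simps\<close>)
  next
    fix Z x y
    assume x: "x \<in> hom C Z P" and y: "y \<in> hom C Z X'" and xy: "\<epsilon> \<cdot> x = ?\<alpha> \<cdot> y"
    have sx: "s \<cdot> x = a \<cdot> (\<rho>1 \<cdot> y)" and tx: "t \<cdot> x = a \<cdot> (\<rho>2 \<cdot> y)"
    proof -
      have "s \<cdot> x = \<pi>1 \<cdot> (\<epsilon> \<cdot> x)" "t \<cdot> x = \<pi>2 \<cdot> (\<epsilon> \<cdot> x)"
        using typing x Comp_eq_extend[OF \<pi>\<epsilon>(1)] Comp_eq_extend[OF \<pi>\<epsilon>(2)] by (auto simp: arrow_simps)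
      then show "s \<cdot> x = a \<cdot> (\<rho>1 \<cdot> y)" "t \<cdot> x = a \<cdot> (\<rho>2 \<cdot> y)"
        using typing y \<alpha>(1) Comp_eq_extend[OF \<alpha>(2)] Comp_eq_extend[OF \<alpha>(3)]
        by (auto simp: arrow_simps xy)
    qed
    have qy: "q \<cdot> (\<rho>1 \<cdot> y) \<in> hom C Z J" "(p \<cdot> s) \<cdot> x = k \<cdot> (q \<cdot> (\<rho>1 \<cdot> y))"
      using typing x y Comp_eq_extend[OF pa] by (auto simp: arrow_simps sx)
    note u = pullback_induced[OF pbb b w x qy]
    let ?u = "induced C b w x (q \<cdot> (\<rho>1 \<cdot> y))"
    have 1: "\<rho>1 \<cdot> (e \<cdot> ?u) = \<rho>1 \<cdot> y"
      by (rule pullback_cancel[OF pba a q])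
        (use typing u y Comp_eq_extend[OF ae(1)] Comp_eq_extend[OF qe] in
          \<open>auto simp: arrow_simps sx\<close>)
    have 2: "\<rho>2 \<cdot> (e \<cdot> ?u) = \<rho>2 \<cdot> y"
      by (rule pullback_cancel[OF pba a q])
        (use typing u y Comp_eq_extend[OF ae(2)] Comp_eq_extend[OF qe2] Comp_eq_extend[OF q\<rho>] in
          \<open>auto simp: arrow_simps tx\<close>)
    have "e \<cdot> ?u \<in> hom C Z X'" using e u(1) by (auto simp: arrow_simps)
    then have "e \<cdot> ?u = y" using pullback_cancel[OF pb\<rho> \<rho> _ y 1 2] by blast
    then show "\<exists>u \<in> hom C Z K. b \<cdot> u = x \<and> e \<cdot> u = y" using u by blast
  next
    fix Z u u'
    assume u: "u \<in> hom C Z K" "u' \<in> hom C Z K" "b \<cdot> u = b \<cdot> u'" "e \<cdot> u = e \<cdot> u'"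
    have "w \<cdot> u = w \<cdot> u'"
      using typing u by (simp add: arrow_simps flip: qe)
    then show "u = u'" using pullback_cancel[OF pbb b w u(1-3)] by blast
  qed
  then have eF: "e \<in> F" using pullback_F[OF \<epsilon>F] by blast

  have \<rho>1e: "\<rho>1 \<cdot> e \<in> Mor C" "Cod C (\<rho>1 \<cdot> e) = Dom C a" using \<rho>e(1) a by (auto simp: hom_def)
  have "pullback C s a b (\<rho>1 \<cdot> e)"
    using pullback_unpaste[OF pba pbb s p \<rho>1e(1) ae(1) qe \<rho>1e(2)] .
  then have \<rho>eW: "\<rho>1 \<cdot> e \<in> W" using pullback_acyclic[OF sWF] by blast
  have ra: "r \<cdot> a \<in> hom C A' P" "(p \<cdot> s) \<cdot> (r \<cdot> a) = k \<cdot> q"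
    using typing Ob Comp_eq_extend[OF sr] by (auto simp: arrow_simps pa)
  \<comment> \<open>\<open>n\<close> is the restriction of \<open>r\<close> to \<open>k\<^sup>*A\<close>.\<close>
  note n = pullback_induced[OF pbb b w ra(1) q ra(2)]
  let ?n = "induced C b w (r \<cdot> a) q"
  have 1: "\<rho>1 \<cdot> (e \<cdot> ?n) = Id C A'"
    by (rule pullback_cancel[OF pba a q])
      (use typing n Ob Comp_eq_extend[OF ae(1)] Comp_eq_extend[OF qe] Comp_eq_extend[OF sr] in
        \<open>auto simp: arrow_simps\<close>)
  have 2: "\<rho>2 \<cdot> (e \<cdot> ?n) = Id C A'"
    by (rule pullback_cancel[OF pba a q])
      (use typing n Ob Comp_eq_extend[OF ae(2)] Comp_eq_extend[OF qe2] Comp_eq_extend[OF tr] in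
        \<open>auto simp: arrow_simps\<close>)
  have nW: "?n \<in> W"
    by (rule section_W[OF n(1) \<rho>e(1) \<rho>eW]) (use typing n(1) 1 in \<open>simp add: arrow_simps\<close>)
  have sq: "e \<cdot> ?n = \<epsilon>' \<cdot> r'"
    by (rule pullback_cancel[OF pb\<rho> \<rho>])
      (use typing n(1) 1 2 s'r' t'r' Comp_eq_extend[OF \<epsilon>'(3)] Comp_eq_extend[OF \<epsilon>'(4)] in
        \<open>auto simp: arrow_simps\<close>)
  show ?thesis
    using weak_equivalence_lift[OF eF e r'W r' n(1) \<epsilon>'(2) sq]
      weak_equivalence_lift[OF \<epsilon>'(1,2) nW n(1) r' e sq[symmetric]] K by blast
qed

lemma path_objects_pullback_stable:
  assumes path: "\<And>p. p \<in> F \<Longrightarrow> fibrewise_path_object p (r p) (s p) (t p)"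
  shows "pullback_stable C F r s t"
  unfolding pullback_stable_def
proof (intro ballI allI impI)
  fix p k \<pi>1 \<pi>2 a q \<rho>1 \<rho>2 b w c z
  assume pF: "p \<in> F" and kM: "k \<in> Mor C"
    and hyp: "Cod C k = Cod C p \<and>
        pullback C p p \<pi>1 \<pi>2 \<and>
        pullback C p k a q \<and>
        pullback C q q \<rho>1 \<rho>2 \<and>
        pullback C (p \<cdot> \<pi>1 \<cdot> induced C \<pi>1 \<pi>2 (s p) (t p)) k b w \<and>
        pullback C (p \<cdot> \<pi>1) k c z"
  define A I J where "A = Dom C p" and "I = Cod C p" and "J = Dom C k"
  have p: "p \<in> hom C A I" using pF F_subset by (auto simp: hom_def A_def I_def)
  have k: "k \<in> hom C J I" using kM hyp by (auto simp: hom_def J_def I_def)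
  have pb\<pi>: "pullback C p p \<pi>1 \<pi>2" and pba: "pullback C p k a q" and pb\<rho>: "pullback C q q \<rho>1 \<rho>2"
    and pbb: "pullback C (p \<cdot> \<pi>1 \<cdot> induced C \<pi>1 \<pi>2 (s p) (t p)) k b w"
    and pbc: "pullback C (p \<cdot> \<pi>1) k c z" using hyp by auto
  obtain X where \<pi>: "\<pi>1 \<in> hom C X A" "\<pi>2 \<in> hom C X A" and p\<pi>: "p \<cdot> \<pi>1 = p \<cdot> \<pi>2"
    using pullback_homs[OF pb\<pi> p p] .
  obtain A' where a: "a \<in> hom C A' A" and q: "q \<in> hom C A' J" and pa: "p \<cdot> a = k \<cdot> q"
    using pullback_homs[OF pba p k] .
  have qF: "q \<in> F" using pullback_F[OF pF pba] .
  obtain X' where \<rho>: "\<rho>1 \<in> hom C X' A'" "\<rho>2 \<in> hom C X' A'"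
    using pullback_homs[OF pb\<rho> q q] .
  obtain P \<epsilon> where st: "s p \<in> hom C P A" "t p \<in> hom C P A" "p \<cdot> s p = p \<cdot> t p"
    and \<epsilon>: "\<epsilon> \<in> hom C P X" "\<pi>1 \<cdot> \<epsilon> = s p" "\<pi>2 \<cdot> \<epsilon> = t p"
    using fibrewise_path_object_cone[OF path[OF pF] pb\<pi> pF p \<pi>] by metis
  have \<epsilon>_eq: "induced C \<pi>1 \<pi>2 (s p) (t p) = \<epsilon>" using induced_eqI[OF pb\<pi> \<pi> \<epsilon>] .
  obtain P' \<epsilon>' where r': "r q \<in> hom C A' P'"
    and \<epsilon>': "\<epsilon>' \<in> F" "\<epsilon>' \<in> hom C P' X'" "\<rho>1 \<cdot> \<epsilon>' = s q" "\<rho>2 \<cdot> \<epsilon>' = t q"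
    using fibrewise_path_object_cone[OF path[OF qF] pb\<rho> qF q \<rho>] by metis
  have \<epsilon>'_eq: "induced C \<rho>1 \<rho>2 (s q) (t q) = \<epsilon>'" using induced_eqI[OF pb\<rho> \<rho> \<epsilon>'(2-4)] .
  have P': "P' = Cod C (r q)" using r' by (simp add: hom_def)
  have pbs: "pullback C (p \<cdot> s p) k b w" using pbb unfolding \<epsilon>_eq \<epsilon>(2) .
  have ps: "p \<cdot> s p \<in> hom C P I" "p \<cdot> \<pi>1 \<in> hom C X I" using p st \<pi> by (auto simp: arrow_simps)
  obtain K where b: "b \<in> hom C K P" and w: "w \<in> hom C K J" and bw: "(p \<cdot> s p) \<cdot> b = k \<cdot> w"
    using pullback_homs[OF pbs ps(1) k] .
  obtain Y where c: "c \<in> hom C Y X" and z: "z \<in> hom C Y J" and cz: "(p \<cdot> \<pi>1) \<cdot> c = k \<cdot> z"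
    using pullback_homs[OF pbc ps(2) k] .
  note typing = p k \<pi> a q \<rho> st(1,2) \<epsilon>(1) b w c z
  have \<epsilon>b: "\<epsilon> \<cdot> b \<in> hom C K X" "(p \<cdot> \<pi>1) \<cdot> (\<epsilon> \<cdot> b) = k \<cdot> w"
    using typing bw Comp_eq_extend[OF \<epsilon>(2)] by (auto simp: arrow_simps)
  note ke = pullback_induced[OF pbc c z \<epsilon>b(1) w \<epsilon>b(2)]
  let ?ke = "induced C c z (\<epsilon> \<cdot> b) w"
  have \<pi>c: "\<pi>1 \<cdot> c \<in> hom C Y A" "\<pi>2 \<cdot> c \<in> hom C Y A" "p \<cdot> (\<pi>1 \<cdot> c) = k \<cdot> z" "p \<cdot> (\<pi>2 \<cdot> c) = k \<cdot> z"
    using typing cz Comp_eq_extend[OF p\<pi>] by (auto simp: arrow_simps)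
  note c1 = pullback_induced[OF pba a q \<pi>c(1) z \<pi>c(3)]
  note c2 = pullback_induced[OF pba a q \<pi>c(2) z \<pi>c(4)]
  let ?c1 = "induced C a q (\<pi>1 \<cdot> c) z" and ?c2 = "induced C a q (\<pi>2 \<cdot> c) z"
  have "q \<cdot> ?c1 = q \<cdot> ?c2" by (simp add: c1 c2)
  note \<theta> = pullback_induced[OF pb\<rho> \<rho> c1(1) c2(1) this]
  let ?\<theta> = "induced C \<rho>1 \<rho>2 ?c1 ?c2"
  note typing = typing ke(1) c1(1) c2(1) \<theta>(1)
  have "(\<exists>m \<in> hom C (Cod C (r q)) (Dom C b). (?\<theta> \<cdot> ?ke) \<cdot> m = \<epsilon>') \<and>
        (\<exists>n \<in> hom C (Dom C b) (Cod C (r q)). \<epsilon>' \<cdot> n = ?\<theta> \<cdot> ?ke)"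
  proof (rule path_object_pullback[OF path[OF pF] pF p k pb\<pi> \<pi> pba a q path[OF qF] pb\<rho> \<rho> pbs])
    show "?\<theta> \<cdot> ?ke \<in> hom C (Dom C b) X'" using typing by (auto simp: arrow_simps)
    have \<rho>\<theta>: "\<rho>1 \<cdot> (?\<theta> \<cdot> ?ke) = ?c1 \<cdot> ?ke" "\<rho>2 \<cdot> (?\<theta> \<cdot> ?ke) = ?c2 \<cdot> ?ke"
      using typing Comp_eq_extend[OF \<theta>(2)] Comp_eq_extend[OF \<theta>(3)] by (auto simp: arrow_simps)
    show "a \<cdot> (\<rho>1 \<cdot> (?\<theta> \<cdot> ?ke)) = s p \<cdot> b" unfolding \<rho>\<theta>
      using typing Comp_eq_extend[OF c1(2)] Comp_eq_extend[OF \<epsilon>(2)] by (simp add: arrow_simps ke(2))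
    show "a \<cdot> (\<rho>2 \<cdot> (?\<theta> \<cdot> ?ke)) = t p \<cdot> b" unfolding \<rho>\<theta>
      using typing Comp_eq_extend[OF c2(2)] Comp_eq_extend[OF \<epsilon>(3)] by (simp add: arrow_simps ke(2))
    show "q \<cdot> (\<rho>1 \<cdot> (?\<theta> \<cdot> ?ke)) = w" unfolding \<rho>\<theta>
      using typing Comp_eq_extend[OF c1(3)] by (simp add: arrow_simps ke(3))
  qed (use \<epsilon>' P' in auto)
  then show "let \<epsilon> = induced C \<pi>1 \<pi>2 (s p) (t p);
             \<epsilon>' = induced C \<rho>1 \<rho>2 (s q) (t q);
             k\<epsilon> = induced C c z (\<epsilon> \<cdot> b) w;
             \<theta> = induced C \<rho>1 \<rho>2 (induced C a q (\<pi>1 \<cdot> c) z) (induced C a q (\<pi>2 \<cdot> c) z)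
         in (\<exists>m \<in> hom C (Cod C (r q)) (Dom C b). (\<theta> \<cdot> k\<epsilon>) \<cdot> m = \<epsilon>') \<and>
            (\<exists>n \<in> hom C (Dom C b) (Cod C (r q)). \<epsilon>' \<cdot> n = \<theta> \<cdot> k\<epsilon>)"
    unfolding Let_def \<epsilon>_eq \<epsilon>'_eq .
qed

lemma propositional_identity_types: "has_propositional_identity_types C F"
proof -
  obtain r s t where path: "\<And>p. p \<in> F \<Longrightarrow> fibrewise_path_object p (r p) (s p) (t p)"
    using fibrewise_path_object_exists by metis
  have "diagonal_factorisations C F r s t"
    using path by (auto simp: diagonal_factorisations_def fibrewise_path_object_def)
  moreover have "propositional_elimination C F r s t"
    unfolding propositional_elimination_def using path_object_elimination[OF path _ path] by blast
  moreover have "pullback_stable C F r s t" using path by (rule path_objects_pullback_stable)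
  ultimately show ?thesis unfolding has_propositional_identity_types_def by blast
qed

lemma fibration_tribe: "tribe C F"
  by (intro tribe.intro category_axioms tribe_axioms.intro)
    (use F_subset iso_F Comp_F terminal_F pullback_F_exists pullback_F in auto)

end

theorem proposition4p5:
  fixes C :: "('o, 'm) cat" and W F :: "'m set"
  assumes "path_category C W F"
  shows "tribe C F \<and> has_propositional_identity_types C F"
  using assms path_category.fibration_tribe path_category.propositional_identity_types by blast

end
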